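(* Let $(f_i)_{i=1}^\infty$ be a sequence of maps, each as in the setting below and each satisfying conditions (i) and (ii). Then the set of numbers $x\in[0,1)$ such that, for every $i\in\mathbb N$ and every $m\in\mathbb N$, $x$ is not $m$-normal to $f_i$, has Hausdorff dimension $1$.
   Context: Setting: $f\colon[0,1)\to[0,1)$ and $g_f\ge 2$ is an integer such that $[0,1)$ is partitioned into $g_f$ half-open intervals $[a,b)$, enumerated as $[0],\dots,[g_f-1]$, such that on each of them $f$ is monotone and maps onto $[0,1)$, and $|f(x)-f(y)|\ge |x-y|$ for all $x,y$ in the same interval. For a word $x_1\dots x_n$ over $\{0,\dots,g_f-1\}$ the generation-$n$ cylinder is $C_{x_1\dots x_n}=\{x\in[0,1): f^{i-1}(x)\in[x_i],\ i=1,\dots,n\}$; $[0,1)$ is the generation-$0$ cylinder. It is assumed that $|C_{x_1\dots x_n}|\to 0$ as $n\to\infty$ for every $(x_i)\in\{0,\dots,g_f-1\}^{\mathbb N}$, so each $x\in[0,1)$ has a unique coding sequence $(x_i)_{i\ge1}$ (its $f$-expansion). Condition (i) (bounded distortion): there is $K_f>0$ such that for every cylinder $C_{x_1\dots x_n}$ (including $[0,1)$), $|(f^n)'(y)|/|(f^n)'(z)|<K_f$ for all $y,z\in C_{x_1\dots x_n}$; this implies $|C_{x_1\dots x_{n+1}}|/|C_{x_1\dots x_n}|>1/(g_fK_f)$ for all sequences and all $n$. Frequencies: for $m\in\mathbb N$ enumerate the $g_f^m$ words of length $m$ as $w_1,\dots,w_{g_f^m}$. For $x$ with $f$-expansion $(x_i)$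 and $n>m$ let $\tau^f_w(x,n)=\#\{i\in\{1,\dots,n-m\}: x_i\dots x_{i+m-1}=w\}$. For $\bar p=(p_{w_1},\dots,p_{w_{g_f^m}})\in[0,1]^{g_f^m}$ with $\sum_j p_{w_j}=1$, let $G^{f,m}_{\bar p}=\{x: \tau^f_{w_j}(x,n)/(n-m)\to p_{w_j}\text{ as }n\to\infty\ \forall j\}$. Condition (ii): for each $m$ there is $\bar p$ with $\dim_H G^{f,m}_{\bar p}=1$, and for each word $w$ of length $m$ and each $\delta>0$ there is $\bar q$ with $q_w\ne p_w$ and $\dim_H G^{f,m}_{\bar q}>1-\delta$. Normality: $x$ is $m$-normal to $f$ if $\tau^f_w(x,n)/(n-m)\to |C_w|$ as $n\to\infty$ for every word $w$ of length $m$, where $|C_w|$ is the length of the cylinder $C_w$. *)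

theory Defs
  imports "HOL-Analysis.Analysis"
begin

definition hausdorff_pre :: "real \<Rightarrow> real \<Rightarrow> real set \<Rightarrow> ennreal" where
  "hausdorff_pre s \<delta> A =
     (INF U \<in> {U :: nat \<Rightarrow> real set. A \<subseteq> (\<Union>i. U i) \<and> (\<forall>i. bounded (U i) \<and> diameter (U i) \<le> \<delta>)}.
        (\<Sum>i. ennreal (diameter (U i) powr s)))"

definition hausdorff_measure :: "real \<Rightarrow> real set \<Rightarrow> ennreal" where
  "hausdorff_measure s A = (SUP \<delta> \<in> {0<..}. hausdorff_pre s \<delta> A)"

definition hausdorff_dim :: "real set \<Rightarrow> real" where
  "hausdorff_dim A = Inf {s::real. 0 \<le> s \<and> hausdorff_measure s A = 0}"

definition part_int :: "(nat \<Rightarrow> real) \<Rightarrow> nat \<Rightarrow> real set" where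
  "part_int a k = {a k ..< a (Suc k)}"

definition words :: "nat \<Rightarrow> nat \<Rightarrow> nat list set" where
  "words g m = {w. length w = m \<and> set w \<subseteq> {..<g}}"

definition cyl :: "(nat \<Rightarrow> real) \<Rightarrow> (real \<Rightarrow> real) \<Rightarrow> nat list \<Rightarrow> real set" where
  "cyl a f w = {x \<in> {0..<1}. \<forall>i<length w. (f ^^ i) x \<in> part_int a (w ! i)}"

definition admissible_map :: "nat \<Rightarrow> (nat \<Rightarrow> real) \<Rightarrow> (real \<Rightarrow> real) \<Rightarrow> bool" where
  "admissible_map g a f \<longleftrightarrow>
     2 \<le> g \<and> a 0 = 0 \<and> a g = 1 \<and> (\<forall>k<g. a k < a (Suc k)) \<and>
     f ` {0..<1} \<subseteq> {0..<1} \<and>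
     (\<forall>k<g. (mono_on (part_int a k) f \<or> antimono_on (part_int a k) f) \<and>
             f ` part_int a k = {0..<1} \<and>
             (\<forall>x\<in>part_int a k. \<forall>y\<in>part_int a k. \<bar>f x - f y\<bar> \<ge> \<bar>x - y\<bar>)) \<and>
     (\<forall>s::nat \<Rightarrow> nat. (\<forall>i. s i < g) \<longrightarrow>
        (\<lambda>n. measure lborel (cyl a f (map s [0..<n]))) \<longlonglongrightarrow> 0)"

text \<open>Condition (i): bounded distortion on every cylinder (including [0,1)).
  Derivatives of f^n are taken within the cylinder (one-sided at its left endpoint).\<close>
definition bounded_distortion :: "nat \<Rightarrow> (nat \<Rightarrow> real) \<Rightarrow> (real \<Rightarrow> real) \<Rightarrow> bool" where
  "bounded_distortion g a f \<longleftrightarrow>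
     (\<exists>K>0. \<forall>n. \<forall>w\<in>words g n. \<exists>D::real \<Rightarrow> real.
        (\<forall>y\<in>cyl a f w. ((f ^^ n) has_real_derivative D y) (at y within cyl a f w)) \<and>
        (\<forall>y\<in>cyl a f w. \<forall>z\<in>cyl a f w. \<bar>D y\<bar> / \<bar>D z\<bar> < K))"

text \<open>Digit x_{i+1} of the f-expansion of x (0-indexed: digit i).\<close>
definition digit :: "nat \<Rightarrow> (nat \<Rightarrow> real) \<Rightarrow> (real \<Rightarrow> real) \<Rightarrow> real \<Rightarrow> nat \<Rightarrow> nat" where
  "digit g a f x i = (THE k. k < g \<and> (f ^^ i) x \<in> part_int a k)"

definition tau :: "nat \<Rightarrow> (nat \<Rightarrow> real) \<Rightarrow> (real \<Rightarrow> real) \<Rightarrow> nat list \<Rightarrow> real \<Rightarrow> nat \<Rightarrow> nat" where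
  "tau g a f w x n =
     card {j. j < n - length w \<and> map (\<lambda>t. digit g a f x (j + t)) [0..<length w] = w}"

definition freq_set :: "nat \<Rightarrow> (nat \<Rightarrow> real) \<Rightarrow> (real \<Rightarrow> real) \<Rightarrow> nat \<Rightarrow> (nat list \<Rightarrow> real) \<Rightarrow> real set" where
  "freq_set g a f m p = {x \<in> {0..<1}. \<forall>w\<in>words g m.
      (\<lambda>n. real (tau g a f w x n) / real (n - m)) \<longlonglongrightarrow> p w}"

definition prob_vector :: "nat \<Rightarrow> nat \<Rightarrow> (nat list \<Rightarrow> real) \<Rightarrow> bool" where
  "prob_vector g m p \<longleftrightarrow> (\<forall>w\<in>words g m. 0 \<le> p w \<and> p w \<le> 1) \<and> (\<Sum>w\<in>words g m. p w) = 1"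

definition cond_ii :: "nat \<Rightarrow> (nat \<Rightarrow> real) \<Rightarrow> (real \<Rightarrow> real) \<Rightarrow> bool" where
  "cond_ii g a f \<longleftrightarrow>
     (\<forall>m\<ge>1. \<exists>p. prob_vector g m p \<and> hausdorff_dim (freq_set g a f m p) = 1 \<and>
        (\<forall>w\<in>words g m. \<forall>\<delta>>0. \<exists>q. prob_vector g m q \<and> q w \<noteq> p w \<and>
            hausdorff_dim (freq_set g a f m q) > 1 - \<delta>))"

definition m_normal :: "nat \<Rightarrow> (nat \<Rightarrow> real) \<Rightarrow> (real \<Rightarrow> real) \<Rightarrow> nat \<Rightarrow> real \<Rightarrow> bool" where
  "m_normal g a f m x \<longleftrightarrow> (\<forall>w\<in>words g m.
      (\<lambda>n. real (tau g a f w x n) / real (n - m)) \<longlonglongrightarrow> measure lborel (cyl a f w))"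

end

theory Submission
  imports Defs
begin

text \<open>
  An m-normal point is 1-normal, and its digit 0 has frequency c, the length of the cylinder of the word 0.
  So for each map it suffices to make the frequency of the digit 0 oscillate away from c.
  Condition (ii) gives, for every t < 1, a set G of dimension above t on which this frequency is
  some q different from c. By bounded distortion the iterate f^n blows every cylinder C of generation n
  up to [0,1) with comparable scaling, so the copy of G inside C has t-dimensional
  content at least a constant times |C|^t.

  Let s < t and suppose that intervals U_j with small total s-cost cover the set of simultaneously
  non-normal points. Call an interval I sparse if the U_j meeting I have s-cost at most \<epsilon>|I|^s.
  A sparse I contains a cylinder C of comparable length. Stop each point of the copy of G
  in C as soon as its cylinder is short and its empirical frequency is far from c. If none of these
  stopped cylinders contained a sparse interval, then they, together with the tripled U_j that are
  longer than a stopped cylinder they meet, would cover the copy of G at too small a t-cost, the gain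
  coming from t > s. Iterating, with every map served infinitely often, yields nested sparse intervals
  whose common point is non-normal for all maps but lies in no U_j.
\<close>

section \<open>Hausdorff content\<close>

text \<open>A lower bound for the t-dimensional Hausdorff content, with no restriction on the scale
  of the covers. Diameters are replaced by majorants \<open>d\<close>, and bounds on all finite sums
  stand for the infinite sum, so everything stays in the reals.\<close>

definition content_ge :: "real \<Rightarrow> real set \<Rightarrow> real \<Rightarrow> bool" where
  "content_ge t A \<kappa> \<longleftrightarrow>
     (\<forall>(U :: nat \<Rightarrow> real set) d B. A \<subseteq> (\<Union>j. U j) \<and> (\<forall>j. 0 \<le> d j) \<and>
        (\<forall>j. \<forall>x\<in>U j. \<forall>y\<in>U j. \<bar>x - y\<bar> \<le> d j) \<and>
        (\<forall>F. finite F \<longrightarrow> (\<Sum>j\<in>F. d j powr t) \<le> B) \<longrightarrow> \<kappa> \<le> B)"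

text \<open>Covers indexed by words, or by a disjoint sum of words and numbers, are transported to
  the naturals by \<open>to_nat\<close>. Indices outside the range receive the empty set with size
  0, which is free because \<open>0 powr t = 0\<close>.\<close>

lemma content_geD:
  fixes U :: "'i::countable \<Rightarrow> real set"
  assumes "content_ge t A \<kappa>" and cov: "A \<subseteq> (\<Union>i\<in>I. U i)" and d: "\<And>i. i \<in> I \<Longrightarrow> 0 \<le> d i"
    and diam: "\<And>i x y. i \<in> I \<Longrightarrow> x \<in> U i \<Longrightarrow> y \<in> U i \<Longrightarrow> \<bar>x - y\<bar> \<le> d i"
    and B: "\<And>F. finite F \<Longrightarrow> F \<subseteq> I \<Longrightarrow> (\<Sum>i\<in>F. d i powr t) \<le> B"
  shows "\<kappa> \<le> B"
proof -
  define U' where "U' n = (if n \<in> to_nat ` I then U (from_nat n) else {})" for n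
  define d' where "d' n = (if n \<in> to_nat ` I then d (from_nat n) else 0)" for n
  have "A \<subseteq> (\<Union>n. U' n)"
  proof
    fix x assume "x \<in> A"
    then obtain i where "i \<in> I" "x \<in> U i" using cov by auto
    then have "x \<in> U' (to_nat i)" by (simp add: U'_def)
    then show "x \<in> (\<Union>n. U' n)" by blast
  qed
  moreover have "\<forall>n. 0 \<le> d' n" using d by (auto simp: d'_def)
  moreover have "\<forall>n. \<forall>x\<in>U' n. \<forall>y\<in>U' n. \<bar>x - y\<bar> \<le> d' n"
    using diam by (auto simp: U'_def d'_def)
  moreover have "(\<Sum>n\<in>F. d' n powr t) \<le> B" if "finite F" for F
  proof -
    define G where "G = {i \<in> I. to_nat i \<in> F}"
    have img: "to_nat ` G = F \<inter> to_nat ` I" by (auto simp: G_def)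
    then have "finite (to_nat ` G)" using that by simp
    then have fin: "finite G" by (rule finite_imageD) (auto simp: inj_on_def)
    have "(\<Sum>n\<in>F. d' n powr t) = (\<Sum>n\<in>to_nat ` G. d' n powr t)"
      unfolding img by (rule sum.mono_neutral_right) (use that in \<open>auto simp: d'_def\<close>)
    also have "\<dots> = (\<Sum>i\<in>G. d' (to_nat i) powr t)"
      by (subst sum.reindex) (auto simp: inj_on_def)
    also have "\<dots> = (\<Sum>i\<in>G. d i powr t)"
      by (rule sum.cong) (auto simp: d'_def G_def)
    also have "\<dots> \<le> B" using fin by (rule B) (auto simp: G_def)
    finally show ?thesis .
  qed
  ultimately show ?thesis using assms(1) unfolding content_ge_def by blast
qed

text \<open>Below the dimension the measure is nonzero, so the pre-measure at some scale \<delta> is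
  positive. A cover with a piece larger than \<delta> already costs at least
  \<open>\<delta> powr t\<close>; every other cover is admissible for that pre-measure. Hence the
  minimum in \<open>\<kappa>\<close>.\<close>

lemma content_ge_if_less_dim:
  assumes "0 < t" "t < hausdorff_dim A"
  shows "\<exists>\<kappa>>0. content_ge t A \<kappa>"
proof -
  have "hausdorff_measure t A \<noteq> 0"
  proof
    assume "hausdorff_measure t A = 0"
    then have "hausdorff_dim A \<le> t"
      unfolding hausdorff_dim_def using assms(1) by (intro cInf_lower) (auto intro: bdd_belowI[of _ 0])
    with assms show False by simp
  qed
  then obtain \<delta> where \<delta>: "\<delta> > 0" "hausdorff_pre t \<delta> A > 0"
    unfolding hausdorff_measure_def
    by (metis (no_types, lifting) SUP_bot_conv(1) bot_ennreal greaterThan_iff zero_less_iff_neq_zero)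
  \<comment> \<open>The pre-measure may be infinite; \<open>k\<close> is a finite positive number
    below it.\<close>
  obtain k where k: "k > 0" "ennreal k \<le> hausdorff_pre t \<delta> A"
    by (metis \<delta>(2) ennreal_cases ennreal_less_zero_iff order_refl top_greatest zero_less_one)
  define \<kappa> where "\<kappa> = min k (\<delta> powr t)"
  have "\<kappa> \<le> B" if U: "A \<subseteq> (\<Union>j. U j)" and d: "\<forall>j. 0 \<le> d j"
    and diam: "\<forall>j. \<forall>x\<in>U j. \<forall>y\<in>U j. \<bar>x - y\<bar> \<le> d j"
    and B: "\<forall>F. finite F \<longrightarrow> (\<Sum>j\<in>F. d j powr t) \<le> B" for U :: "nat \<Rightarrow> real set" and d B
  proof (rule ccontr)
    assume "\<not> \<kappa> \<le> B"
    then have Bk: "B < k" "B < \<delta> powr t" by (auto simp: \<kappa>_def)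
    have B0: "0 \<le> B" using B[rule_format, of "{}"] by simp
    have diamU: "diameter (U j) \<le> d j" for j
      by (rule diameter_le) (use d diam in auto)
    have bdd: "bounded (U j)" for j
    proof (cases "U j = {}")
      case False
      then obtain x where "x \<in> U j" by auto
      then have "\<forall>y\<in>U j. dist x y \<le> d j" using diam by (auto simp: dist_real_def)
      then show ?thesis unfolding bounded_def by blast
    qed auto
    have d\<delta>: "d j \<le> \<delta>" for j
    proof (rule ccontr)
      assume "\<not> d j \<le> \<delta>"
      then have "\<delta> powr t \<le> d j powr t" using \<delta>(1) assms(1) by (intro powr_mono2) auto
      moreover have "d j powr t \<le> B" using B[rule_format, of "{j}"] by simp
      ultimately show False using Bk by simp
    qed
    have "hausdorff_pre t \<delta> A \<le> (\<Sum>j. ennreal (diameter (U j) powr t))"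
      unfolding hausdorff_pre_def
      by (rule INF_lower) (use U bdd order_trans[OF diamU d\<delta>] in auto)
    also have "\<dots> \<le> ennreal B"
      unfolding suminf_eq_SUP
    proof (rule SUP_least)
      fix n
      have "(\<Sum>j<n. ennreal (diameter (U j) powr t)) = ennreal (\<Sum>j<n. diameter (U j) powr t)"
        by (rule sum_ennreal) simp
      also have "\<dots> \<le> ennreal (\<Sum>j<n. d j powr t)"
        by (intro ennreal_leI sum_mono powr_mono2) (use assms(1) diamU diameter_ge_0[OF bdd] in auto)
      also have "\<dots> \<le> ennreal B" using B by (intro ennreal_leI) auto
      finally show "(\<Sum>j<n. ennreal (diameter (U j) powr t)) \<le> ennreal B" .
    qed
    finally have "ennreal k \<le> ennreal B" using k(2) by (rule order_trans[rotated])
    then show False using Bk(1) B0 k by (simp add: ennreal_le_iff)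
  qed
  then have "content_ge t A \<kappa>" unfolding content_ge_def by (intro allI impI) (elim conjE)
  moreover have "\<kappa> > 0" using k \<delta> by (simp add: \<kappa>_def)
  ultimately show ?thesis by blast
qed

text \<open>Each piece of a cheap cover lies in a closed interval that starts at its infimum and has
  its diameter as length. The lengths are enlarged a little so that none is zero: the positive cost
  of every single interval is what later keeps the limit point out of the cover.\<close>

lemma small_interval_cover:
  assumes "hausdorff_measure s X = 0" "0 < s" "0 < \<eta>"
  shows "\<exists>p e :: nat \<Rightarrow> real. (\<forall>j. 0 < e j) \<and> X \<subseteq> (\<Union>j. {p j..p j + e j}) \<and>
    (\<forall>F. finite F \<longrightarrow> (\<Sum>j\<in>F. e j powr s) \<le> \<eta>)"
proof -
  have "hausdorff_pre s 1 X \<le> hausdorff_measure s X"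
    unfolding hausdorff_measure_def by (rule SUP_upper) simp
  then have "hausdorff_pre s 1 X < ennreal (\<eta> / 2)" using assms by simp
  then obtain U :: "nat \<Rightarrow> real set" where U: "X \<subseteq> (\<Union>i. U i)" "\<And>i. bounded (U i)"
    "(\<Sum>i. ennreal (diameter (U i) powr s)) < ennreal (\<eta> / 2)"
    unfolding hausdorff_pre_def INF_less_iff by auto
  define D where "D j = diameter (U j) powr s" for j
  \<comment> \<open>Chosen so that \<open>e j powr s\<close> exceeds \<open>D j\<close> by a term of
    a geometric series with sum \<open>\<eta> / 2\<close>; the other half of the budget pays for the
    diameters.\<close>
  define e where "e j = (D j + \<eta> / 2 * (1/2) ^ Suc j) powr (1 / s)" for j
  have D0: "0 \<le> D j" for j by (simp add: D_def)
  have pos: "0 < D j + \<eta> / 2 * (1/2) ^ Suc j" for j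
    using D0[of j] assms by (intro add_nonneg_pos) auto
  have es: "e j powr s = D j + \<eta> / 2 * (1/2) ^ Suc j" for j
    using pos[of j] assms by (simp add: e_def powr_powr)
  have "0 < e j" for j using pos[of j] by (simp add: e_def del: power_Suc)
  moreover have "X \<subseteq> (\<Union>j. {Inf (U j)..Inf (U j) + e j})"
  proof
    fix x assume "x \<in> X"
    then obtain j where j: "x \<in> U j" using U by auto
    have bb: "bdd_below (U j)" using U(2) by (simp add: bounded_imp_bdd_below)
    have "Inf (U j) \<le> x" using j bb by (rule cInf_lower)
    moreover have "x - diameter (U j) \<le> Inf (U j)"
    proof (rule cInf_greatest)
      fix y assume "y \<in> U j"
      then have "dist x y \<le> diameter (U j)" using U(2) j by (intro diameter_bounded_bound)
      then show "x - diameter (U j) \<le> y" by (simp add: dist_real_def)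
    qed (use j in auto)
    moreover have "diameter (U j) \<le> e j"
    proof -
      have "diameter (U j) = D j powr (1 / s)"
        using assms diameter_ge_0[OF U(2)] by (simp add: D_def powr_powr)
      also have "\<dots> \<le> e j" unfolding e_def using assms D0 by (intro powr_mono2) auto
      finally show ?thesis .
    qed
    ultimately show "x \<in> (\<Union>j. {Inf (U j)..Inf (U j) + e j})" by force
  qed
  moreover have "(\<Sum>j\<in>F. e j powr s) \<le> \<eta>" if "finite F" for F
  proof -
    have "ennreal (\<Sum>j\<in>F. D j) = (\<Sum>j\<in>F. ennreal (D j))" by (simp add: D0 sum_ennreal)
    also have "\<dots> \<le> (\<Sum>j. ennreal (D j))" using that by (intro sum_le_suminf) auto
    also have "\<dots> \<le> ennreal (\<eta> / 2)" using U(3) by (simp add: D_def)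
    finally have 1: "(\<Sum>j\<in>F. D j) \<le> \<eta> / 2" using assms by (subst (asm) ennreal_le_iff) auto
    have sm: "(\<lambda>j. (1/2::real) ^ Suc j) sums 1" by (rule power_half_series)
    have "(\<Sum>j\<in>F. (1/2::real) ^ Suc j) \<le> (\<Sum>j. (1/2::real) ^ Suc j)"
      using sm that by (intro sum_le_suminf) (auto simp: sums_iff)
    also have "\<dots> = 1" using sm by (rule sums_unique[symmetric])
    finally have "\<eta> / 2 * (\<Sum>j\<in>F. (1/2::real) ^ Suc j) \<le> \<eta> / 2 * 1"
      using assms by (intro mult_left_mono) auto
    with 1 show ?thesis by (simp add: es sum.distrib sum_distrib_left del: power_Suc)
  qed
  ultimately have "(\<forall>j. 0 < e j) \<and> X \<subseteq> (\<Union>j. {Inf (U j)..Inf (U j) + e j}) \<and>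
      (\<forall>F. finite F \<longrightarrow> (\<Sum>j\<in>F. e j powr s) \<le> \<eta>)" by simp
  then show ?thesis by (intro exI[of _ "\<lambda>j. Inf (U j)"] exI[of _ e])
qed

section \<open>Hausdorff dimension of subsets of the unit interval\<close>

lemma hausdorff_pre_mono:
  assumes "A \<subseteq> B" shows "hausdorff_pre s \<delta> A \<le> hausdorff_pre s \<delta> B"
  unfolding hausdorff_pre_def using assms by (intro INF_superset_mono) auto

text \<open>Cutting into n equal closed intervals costs \<open>n * (1 / n) powr s\<close>, which
  tends to 0 because s exceeds 1.\<close>

lemma hausdorff_measure_unit_interval:
  assumes "s > 1" shows "hausdorff_measure s {0..<1} = 0"
proof -
  have "hausdorff_pre s \<delta> {0..<1} \<le> 0" if "\<delta> > 0" for \<delta>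
  proof (rule ennreal_le_epsilon)
    fix \<epsilon> :: real assume "\<epsilon> > 0"
    have "(\<lambda>n. real n powr (1 - s)) \<longlonglongrightarrow> 0"
      using assms by (intro tendsto_neg_powr filterlim_real_sequentially) auto
    then have ev: "eventually (\<lambda>n. real n powr (1 - s) < \<epsilon>) sequentially"
      using \<open>\<epsilon> > 0\<close> by (rule order_tendstoD)
    obtain m :: nat where m: "inverse (real (Suc m)) < \<delta>" using reals_Archimedean[OF \<open>\<delta> > 0\<close>] by blast
    obtain n where n: "n \<ge> Suc m" "real n powr (1 - s) < \<epsilon>"
      using eventually_happens'[OF _ eventually_conj[OF ev eventually_ge_at_top[of "Suc m"]]] by auto
    have n0: "n > 0" using n by simp
    have n\<delta>: "1 / real n \<le> \<delta>"
      using m n(1) by (smt (verit) frac_le inverse_eq_divide of_nat_0_less_iff of_nat_mono zero_less_Suc)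
    define U where "U i = (if i < n then {real i / n..(real i + 1) / n} else {})" for i
    have dm: "diameter (U i) = (if i < n then 1 / n else 0)" for i
    proof (cases "i < n")
      case True
      have "real i / n \<le> (real i + 1) / n" by (rule divide_right_mono) auto
      then show ?thesis using True by (simp add: U_def diameter_closed_interval diff_divide_distrib[symmetric])
    qed (simp add: U_def)
    have "{0..<1} \<subseteq> (\<Union>i. U i)"
    proof
      fix x :: real assume x: "x \<in> {0..<1}"
      define i where "i = nat \<lfloor>x * n\<rfloor>"
      have "real i \<le> x * n" "x * n < real i + 1"
        using x by (auto simp: i_def)
      moreover have "x * n < n" using x n0 by simp
      ultimately have "i < n" "real i \<le> x * n" "x * n < real i + 1" by linarith+
      then have "x \<in> U i" using n0 by (auto simp: U_def field_simps)
      then show "x \<in> (\<Union>i. U i)" by blast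
    qed
    then have "hausdorff_pre s \<delta> {0..<1} \<le> (\<Sum>i. ennreal (diameter (U i) powr s))"
      unfolding hausdorff_pre_def
      by (intro INF_lower) (use n\<delta> that in \<open>auto simp: dm\<close>, auto simp: U_def)
    also have "\<dots> = (\<Sum>i<n. ennreal (diameter (U i) powr s))"
      by (rule suminf_finite) (auto simp: dm)
    also have "\<dots> = ennreal (real n * (1 / n) powr s)"
      by (simp add: dm ennreal_mult ennreal_of_nat_eq_real_of_nat)
    also have "real n * (1 / n) powr s = real n powr (1 - s)"
      using n0 by (simp add: powr_diff powr_divide)
    finally show "hausdorff_pre s \<delta> {0..<1} \<le> 0 + ennreal \<epsilon>"
      using n(2) by (simp add: order_trans[OF _ ennreal_leI])
  qed
  then show ?thesis unfolding hausdorff_measure_def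
    by (intro antisym SUP_least) auto
qed

text \<open>For diameters at most 1 the cost decreases as the exponent grows, so the scale is first
  cut down to \<open>min \<delta> 1\<close>.\<close>

lemma hausdorff_measure_zero_mono:
  assumes "hausdorff_measure s A = 0" "0 \<le> s" "s \<le> t"
  shows "hausdorff_measure t A = 0"
proof -
  have "hausdorff_pre t \<delta> A \<le> 0" if "\<delta> > 0" for \<delta>
  proof -
    have "hausdorff_pre t \<delta> A \<le> hausdorff_pre t (min \<delta> 1) A"
      unfolding hausdorff_pre_def by (intro INF_superset_mono) auto
    also have "\<dots> \<le> hausdorff_pre s (min \<delta> 1) A"
      unfolding hausdorff_pre_def
    proof (rule INF_mono)
      fix U :: "nat \<Rightarrow> real set"
      assume U: "U \<in> {U. A \<subseteq> (\<Union>i. U i) \<and> (\<forall>i. bounded (U i) \<and> diameter (U i) \<le> min \<delta> 1)}"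
      have "(\<Sum>i. ennreal (diameter (U i) powr t)) \<le> (\<Sum>i. ennreal (diameter (U i) powr s))"
        by (intro suminf_le ennreal_leI powr_mono') (use U assms in \<open>auto intro: diameter_ge_0\<close>)
      with U show "\<exists>V\<in>{U. A \<subseteq> (\<Union>i. U i) \<and> (\<forall>i. bounded (U i) \<and> diameter (U i) \<le> min \<delta> 1)}.
          (\<Sum>i. ennreal (diameter (V i) powr t)) \<le> (\<Sum>i. ennreal (diameter (U i) powr s))"
        by blast
    qed
    also have "\<dots> \<le> hausdorff_measure s A"
      unfolding hausdorff_measure_def by (rule SUP_upper) (use that in auto)
    finally show ?thesis using assms by simp
  qed
  then show ?thesis unfolding hausdorff_measure_def
    by (intro antisym SUP_least) auto
qed

lemma hausdorff_dim_eq_1: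
  assumes "X \<subseteq> {0..<1}" "\<And>s. 0 < s \<Longrightarrow> s < 1 \<Longrightarrow> hausdorff_measure s X \<noteq> 0"
  shows "hausdorff_dim X = 1"
proof (rule antisym)
  have z: "hausdorff_measure s X = 0" if "s > 1" for s
  proof -
    have "hausdorff_measure s X \<le> hausdorff_measure s {0..<1}"
      unfolding hausdorff_measure_def using assms(1) by (intro SUP_mono) (auto intro: hausdorff_pre_mono)
    then show ?thesis using hausdorff_measure_unit_interval[OF that] by simp
  qed
  show "hausdorff_dim X \<le> 1"
  proof (rule field_le_epsilon)
    fix \<epsilon> :: real assume "\<epsilon> > 0"
    then show "hausdorff_dim X \<le> 1 + \<epsilon>"
      unfolding hausdorff_dim_def using z[of "1 + \<epsilon>"]
      by (intro cInf_lower) (auto intro: bdd_belowI[of _ 0])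
  qed
  show "1 \<le> hausdorff_dim X"
    unfolding hausdorff_dim_def
  proof (rule cInf_greatest)
    show "{s. 0 \<le> s \<and> hausdorff_measure s X = 0} \<noteq> {}" using z[of 2] by (auto intro: exI[of _ 2])
    fix s assume s: "s \<in> {s. 0 \<le> s \<and> hausdorff_measure s X = 0}"
    show "1 \<le> s"
    proof (rule ccontr)
      assume "\<not> 1 \<le> s"
      \<comment> \<open>Here s may be 0; its midpoint with 1 lies strictly between 0 and 1, and the
        measure still vanishes at that larger exponent.\<close>
      then show False using s assms(2)[of "(s + 1) / 2"] hausdorff_measure_zero_mono[of s X "(s + 1) / 2"]
        by auto
    qed
  qed
qed

section \<open>Cylinders and digit frequencies\<close>

text \<open>Surjectivity onto [0,1) does the work of continuity: the ends are the points mapped to u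
  and v. The value 1 is never attained, so for v = 1 the preimage extends up to r.\<close>

lemma strict_mono_preimage_interval:
  fixes h :: "real \<Rightarrow> real"
  assumes mono: "strict_mono_on {l..<r} h" and img: "h ` {l..<r} = {0..<1}"
    and uv: "0 \<le> u" "u < v" "v \<le> 1"
  obtains l' r' where "l \<le> l'" "l' < r'" "r' \<le> r" "{x \<in> {l..<r}. h x \<in> {u..<v}} = {l'..<r'}"
proof -
  have "u \<in> h ` {l..<r}" using img uv by auto
  then obtain l' where l': "l' \<in> {l..<r}" "h l' = u" by auto
  have "\<exists>r'. r' \<le> r \<and> l' < r' \<and> (\<forall>x\<in>{l..<r}. h x < v \<longleftrightarrow> x < r')"
  proof (cases "v < 1")
    case True
    then have "v \<in> h ` {l..<r}" using img uv by auto
    then obtain r' where r': "r' \<in> {l..<r}" "h r' = v" by auto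
    then show ?thesis
      using strict_mono_on_less[OF mono _ r'(1)] l' uv by (intro exI[of _ r']) auto
  next
    case False
    then have "h x < v" if "x \<in> {l..<r}" for x using img that uv by (metis atLeastLessThan_iff image_eqI order.strict_trans2 not_le)
    then show ?thesis using l' by (intro exI[of _ r]) auto
  qed
  then obtain r' where r': "r' \<le> r" "l' < r'" "\<And>x. x \<in> {l..<r} \<Longrightarrow> h x < v \<longleftrightarrow> x < r'" by auto
  have "u \<le> h x \<longleftrightarrow> l' \<le> x" if "x \<in> {l..<r}" for x
    using strict_mono_on_less_eq[OF mono l'(1) that] l' by simp
  then have "{x \<in> {l..<r}. h x \<in> {u..<v}} = {l'..<r'}" using r' l' by auto
  then show ?thesis using that[of l' r'] l' r' by auto
qed

lemma cyl_snoc: "cyl a f (w @ [k]) = {x \<in> cyl a f w. (f ^^ length w) x \<in> part_int a k}"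
  by (auto simp: cyl_def nth_append less_Suc_eq)

section \<open>Branches, digits and prefixes of a single map\<close>

locale expanding_map =
  fixes g :: nat and a :: "nat \<Rightarrow> real" and f :: "real \<Rightarrow> real"
  assumes admissible: "admissible_map g a f" and distortion: "bounded_distortion g a f"
begin

abbreviation len :: "nat list \<Rightarrow> real" where
  "len w \<equiv> measure lborel (cyl a f w)"

abbreviation zero_count :: "real \<Rightarrow> nat \<Rightarrow> nat" where
  "zero_count x N \<equiv> card {j. j < N \<and> digit g a f x j = 0}"

definition coding :: "real \<Rightarrow> nat \<Rightarrow> nat list" where
  "coding x n = map (digit g a f x) [0..<n]"

lemma g_ge_2: "2 \<le> g" and a_0: "a 0 = 0" and a_g: "a g = 1" and a_less: "k < g \<Longrightarrow> a k < a (Suc k)"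
  and f_image: "k < g \<Longrightarrow> f ` part_int a k = {0..<1}"
  and f_expand: "k < g \<Longrightarrow> x \<in> part_int a k \<Longrightarrow> y \<in> part_int a k \<Longrightarrow> \<bar>x - y\<bar> \<le> \<bar>f x - f y\<bar>"
  and f_maps: "f ` {0..<1} \<subseteq> {0..<1}"
  and len_tendsto_0: "(\<And>i. s i < g) \<Longrightarrow> (\<lambda>n. len (map s [0..<n])) \<longlonglongrightarrow> 0"
  using admissible by (auto simp: admissible_map_def)

lemma a_mono: "j \<le> k \<Longrightarrow> k \<le> g \<Longrightarrow> a j \<le> a k"
proof (induction rule: dec_induct)
  case (step n)
  then show ?case using a_less[of n] by simp
qed simp

lemma a_bounds: "k \<le> g \<Longrightarrow> 0 \<le> a k \<and> a k \<le> 1"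
  using a_mono[of 0 k] a_mono[of k g] a_0 a_g by simp

lemma part_int_subset: "k < g \<Longrightarrow> part_int a k \<subseteq> {0..<1}"
  using a_bounds[of k] a_bounds[of "Suc k"] by (auto simp: part_int_def)

lemma f_strict_mono: 
  assumes k: "k < g" shows "strict_mono_on (part_int a k) f"
proof (rule strict_mono_onI)
  fix x y assume xy: "x \<in> part_int a k" "y \<in> part_int a k" "x < y"
  have ne: "f x \<noteq> f y" using f_expand[OF k xy(1,2)] xy by auto
  have "mono_on (part_int a k) f \<or> antimono_on (part_int a k) f"
    using admissible k by (auto simp: admissible_map_def)
  moreover have "\<not> antimono_on (part_int a k) f"
  proof
    assume anti: "antimono_on (part_int a k) f"
    \<comment> \<open>a decreasing branch would attain its supremum at the left endpoint\<close>
    have ak: "a k \<in> part_int a k" using a_less[OF k] by (simp add: part_int_def)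
    then have "f (a k) \<in> {0..<1}" using f_image[OF k] by blast
    then have "(f (a k) + 1) / 2 \<in> f ` part_int a k" unfolding f_image[OF k] by auto
    then obtain z where z: "z \<in> part_int a k" "f z = (f (a k) + 1) / 2" by auto
    have "f z \<le> f (a k)" using monotone_onD[OF anti ak z(1)] z(1) by (auto simp: part_int_def)
    then show False using z \<open>f (a k) \<in> {0..<1}\<close> by auto
  qed
  ultimately have "mono_on (part_int a k) f" by blast
  from mono_onD[OF this xy(1,2)] have "f x \<le> f y" using xy(3) by simp
  with ne show "f x < f y" by simp
qed

lemma orbit: "x \<in> {0..<1} \<Longrightarrow> (f ^^ i) x \<in> {0..<1}"
proof (induction i)
  case (Suc i)
  then have "f ((f ^^ i) x) \<in> {0..<1}" using f_maps by blast
  then show ?case by simp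
qed simp

lemma part_int_ex1:
  assumes x: "x \<in> {0..<1}" shows "\<exists>!k. k < g \<and> x \<in> part_int a k"
proof -
  have "x < a n \<Longrightarrow> n \<le> g \<Longrightarrow> \<exists>k<n. x \<in> part_int a k" for n
  proof (induction n)
    case 0 then show ?case using x a_0 by simp
  next
    case (Suc n)
    then show ?case by (cases "x < a n") (auto simp: part_int_def intro: less_SucI)
  qed
  then have ex: "\<exists>k<g. x \<in> part_int a k" using x a_g by auto
  have "\<not> j < k" if "x \<in> part_int a j" "x \<in> part_int a k" "k < g" for j k
    using a_mono[of "Suc j" k] that by (auto simp: part_int_def)
  then show ?thesis using ex by (metis linorder_neqE_nat)
qed

lemma digit_eq_iff:
  assumes "x \<in> {0..<1}"
  shows "digit g a f x i = k \<longleftrightarrow> k < g \<and> (f ^^ i) x \<in> part_int a k"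
  using theI'[OF part_int_ex1[OF orbit[OF assms, of i]]] part_int_ex1[OF orbit[OF assms, of i]]
  unfolding digit_def by blast

lemma digit_less: "x \<in> {0..<1} \<Longrightarrow> digit g a f x i < g"
  using digit_eq_iff by blast

lemma digit_shift: 
  assumes "x \<in> {0..<1}" shows "digit g a f ((f ^^ n) x) i = digit g a f x (n + i)"
proof -
  have "(f ^^ i) ((f ^^ n) x) = (f ^^ (n + i)) x" by (simp only: funpow_add add.commute[of n] comp_apply)
  then show ?thesis by (simp add: digit_def)
qed

lemma length_coding [simp]: "length (coding x n) = n"
  and take_coding: "m \<le> n \<Longrightarrow> take m (coding x n) = coding x m"
  and coding_Suc: "coding x (Suc n) = coding x n @ [digit g a f x n]"
  by (simp_all add: coding_def take_map)

lemma set_coding: "x \<in> {0..<1} \<Longrightarrow> set (coding x n) \<subseteq> {..<g}"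
  by (auto simp: coding_def digit_less)

text \<open>Reduces nesting and disjointness of cylinders to comparing prefixes of
  expansions.\<close>

lemma mem_cyl_iff:
  assumes "set w \<subseteq> {..<g}"
  shows "x \<in> cyl a f w \<longleftrightarrow> x \<in> {0..<1} \<and> coding x (length w) = w"
proof -
  have "(\<forall>i<length w. (f ^^ i) x \<in> part_int a (w ! i)) \<longleftrightarrow> (\<forall>i<length w. digit g a f x i = w ! i)"
    if "x \<in> {0..<1}"
  proof -
    have "w ! i < g" if "i < length w" for i using assms nth_mem[OF that] by auto
    then show ?thesis using digit_eq_iff[OF that] by simp
  qed
  moreover have "coding x (length w) = w \<longleftrightarrow> (\<forall>i<length w. digit g a f x i = w ! i)"
    by (subst list_eq_iff_nth_eq) (simp add: coding_def)
  ultimately show ?thesis unfolding cyl_def by blast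
qed

lemma mem_cyl_coding: "x \<in> {0..<1} \<Longrightarrow> x \<in> cyl a f (coding x n)"
  by (simp add: mem_cyl_iff set_coding)

lemma len_coding_tendsto_0: "x \<in> {0..<1} \<Longrightarrow> (\<lambda>n. len (coding x n)) \<longlonglongrightarrow> 0"
  unfolding coding_def by (rule len_tendsto_0) (rule digit_less)

text \<open>This makes a deviation of the frequency seen at time N hold on a whole cylinder of
  generation N.\<close>

lemma zero_count_cong:
  assumes "coding x N = coding y N" shows "zero_count x N = zero_count y N"
proof -
  have "digit g a f x j = digit g a f y j" if "j < N" for j
    using arg_cong[OF assms, of "\<lambda>w. w ! j"] that by (simp add: coding_def)
  then have "{j. j < N \<and> digit g a f x j = 0} = {j. j < N \<and> digit g a f y j = 0}" by auto
  then show ?thesis by simp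
qed

text \<open>Induction by appending a digit k: the new cylinder is the preimage of branch k under the
  increasing iterate of the old one, hence again half-open, and the next application of
  \<open>f\<close> stretches that branch onto [0,1).\<close>

lemma cyl_structure:
  assumes "set w \<subseteq> {..<g}"
  shows "\<exists>l r. 0 \<le> l \<and> l < r \<and> r \<le> 1 \<and> cyl a f w = {l..<r} \<and>
    strict_mono_on {l..<r} (f ^^ length w) \<and> (f ^^ length w) ` {l..<r} = {0..<1} \<and>
    (\<forall>x\<in>{l..<r}. \<forall>y\<in>{l..<r}. \<bar>x - y\<bar> \<le> \<bar>(f ^^ length w) x - (f ^^ length w) y\<bar>)"
  using assms
proof (induction w rule: rev_induct)
  case Nil
  have "cyl a f [] = {0..<1}" by (auto simp: cyl_def)
  then show ?case by (intro exI[of _ 0] exI[of _ 1]) (auto intro: strict_mono_onI)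
next
  case (snoc k w)
  then obtain l r where lr: "0 \<le> l" "l < r" "r \<le> 1" "cyl a f w = {l..<r}"
    "strict_mono_on {l..<r} (f ^^ length w)" "(f ^^ length w) ` {l..<r} = {0..<1}"
    and ex: "\<And>x y. x \<in> {l..<r} \<Longrightarrow> y \<in> {l..<r} \<Longrightarrow> \<bar>x - y\<bar> \<le> \<bar>(f ^^ length w) x - (f ^^ length w) y\<bar>"
    by auto
  let ?h = "f ^^ length w"
  have k: "k < g" using snoc by simp
  obtain l' r' where lr': "l \<le> l'" "l' < r'" "r' \<le> r" "{x \<in> {l..<r}. ?h x \<in> part_int a k} = {l'..<r'}"
    using strict_mono_preimage_interval[OF lr(5,6), of "a k" "a (Suc k)"] a_bounds[of k] a_bounds[of "Suc k"]
      a_less[OF k] k unfolding part_int_def by auto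
  have c: "cyl a f (w @ [k]) = {l'..<r'}" using lr' lr by (simp add: cyl_snoc)
  have sub: "{l'..<r'} \<subseteq> {l..<r}" using lr' by auto
  have hp: "?h x \<in> part_int a k" if "x \<in> {l'..<r'}" for x using lr'(4) that by blast
  have img: "?h ` {l'..<r'} = part_int a k"
  proof
    show "part_int a k \<subseteq> ?h ` {l'..<r'}"
    proof
      fix y assume y: "y \<in> part_int a k"
      then have "y \<in> ?h ` {l..<r}" using lr(6) part_int_subset[OF k] by auto
      then obtain x where "x \<in> {l..<r}" "y = ?h x" by auto
      then have "x \<in> {l'..<r'}" using y lr'(4) by blast
      then show "y \<in> ?h ` {l'..<r'}" using \<open>y = ?h x\<close> by blast
    qed
  qed (use hp in auto)
  have "strict_mono_on {l'..<r'} (f \<circ> ?h)"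
  proof (rule strict_mono_onI)
    fix x y assume "x \<in> {l'..<r'}" "y \<in> {l'..<r'}" "x < y"
    then show "(f \<circ> ?h) x < (f \<circ> ?h) y"
      using strict_mono_onD[OF lr(5), of x y] strict_mono_onD[OF f_strict_mono[OF k] hp hp, of x y] sub by auto
  qed
  moreover have "(f \<circ> ?h) ` {l'..<r'} = {0..<1}" using img f_image[OF k] by (simp only: image_comp[symmetric])
  moreover have "\<bar>x - y\<bar> \<le> \<bar>(f \<circ> ?h) x - (f \<circ> ?h) y\<bar>" if "x \<in> {l'..<r'}" "y \<in> {l'..<r'}" for x y
    using order_trans[OF ex f_expand[OF k hp[OF that(1)] hp[OF that(2)]]] that sub by auto
  moreover have "f ^^ length (w @ [k]) = f \<circ> ?h" by simp
  moreover have "0 \<le> l'" "r' \<le> 1" using lr lr' by auto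
  ultimately show ?case using lr'(2) c by metis
qed

section \<open>Lengths of cylinders and bounded distortion\<close>

definition cyl_lo :: "nat list \<Rightarrow> real" where "cyl_lo w = Inf (cyl a f w)"
definition cyl_hi :: "nat list \<Rightarrow> real" where "cyl_hi w = Sup (cyl a f w)"

context
  fixes w assumes w: "set w \<subseteq> {..<g}"
begin

lemma cyl_eq: "cyl a f w = {cyl_lo w..<cyl_hi w}"
  and cyl_lo_less_hi: "cyl_lo w < cyl_hi w"
  and strict_mono_iterate: "strict_mono_on (cyl a f w) (f ^^ length w)"
  and image_iterate: "(f ^^ length w) ` cyl a f w = {0..<1}"
  and expand_iterate: "x \<in> cyl a f w \<Longrightarrow> y \<in> cyl a f w \<Longrightarrow>
        \<bar>x - y\<bar> \<le> \<bar>(f ^^ length w) x - (f ^^ length w) y\<bar>"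
  using cyl_structure[OF w] by (auto simp: cyl_lo_def cyl_hi_def)

lemma len_eq: "len w = cyl_hi w - cyl_lo w"
  using cyl_lo_less_hi by (simp add: cyl_eq)

lemma len_pos: "0 < len w"
  using cyl_lo_less_hi by (simp add: len_eq)

lemma abs_diff_le_len: "x \<in> cyl a f w \<Longrightarrow> y \<in> cyl a f w \<Longrightarrow> \<bar>x - y\<bar> \<le> len w"
  by (auto simp: cyl_eq len_eq)

end

text \<open>Bounded distortion in integrated form. The slope between x and y is a derivative value,
  and so is the slope between the left end and a point near the right end; the latter is at most
  about \<open>1 / len w\<close>, since the image has length 1, and the two differ by a factor at
  most K.\<close>

lemma iterate_lipschitz:
  "\<exists>K>0. \<forall>w x y. set w \<subseteq> {..<g} \<longrightarrow> x \<in> cyl a f w \<longrightarrow> y \<in> cyl a f w \<longrightarrow>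
    \<bar>(f ^^ length w) x - (f ^^ length w) y\<bar> * len w \<le> K * \<bar>x - y\<bar>"
proof -
  obtain K where K: "K > 0" and D: "\<And>n w. w \<in> words g n \<Longrightarrow> \<exists>D::real \<Rightarrow> real.
        (\<forall>y\<in>cyl a f w. ((f ^^ n) has_real_derivative D y) (at y within cyl a f w)) \<and>
        (\<forall>y\<in>cyl a f w. \<forall>z\<in>cyl a f w. \<bar>D y\<bar> / \<bar>D z\<bar> < K)"
    using distortion unfolding bounded_distortion_def by blast
  have less: "\<bar>(f ^^ length w) x - (f ^^ length w) y\<bar> * len w \<le> K * \<bar>x - y\<bar>"
    if w: "set w \<subseteq> {..<g}" and x: "x \<in> cyl a f w" and y: "y \<in> cyl a f w" and xy: "x < y" for w x y
  proof -
    let ?h = "f ^^ length w"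
    have "w \<in> words g (length w)" using w by (simp add: words_def)
    from D[OF this] obtain D where der: "\<And>y. y \<in> cyl a f w \<Longrightarrow> (?h has_real_derivative D y) (at y within cyl a f w)"
      and dist: "\<And>y z. y \<in> cyl a f w \<Longrightarrow> z \<in> cyl a f w \<Longrightarrow> \<bar>D y\<bar> / \<bar>D z\<bar> < K"
      by blast
    \<comment> \<open>Expansion makes the derivative at the mean value point at least 1, so the
      quotient bound is never read at a zero denominator.\<close>
    have mvt: "\<exists>z\<in>cyl a f w. ?h v - ?h u = D z * (v - u) \<and> 1 \<le> D z"
      if uv: "u \<in> cyl a f w" "v \<in> cyl a f w" "u < v" for u v
    proof -
      have sub: "{u..v} \<subseteq> cyl a f w" using uv by (auto simp: cyl_eq[OF w])
      have "\<exists>z\<in>{u<..<v}. ?h v - ?h u = (*) (D z) (v - u)"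
      proof (rule mvt_simple[OF uv(3)])
        fix z assume "u \<le> z" "z \<le> v"
        then show "(?h has_derivative (*) (D z)) (at z within {u..v})"
          using der[of z] sub unfolding has_field_derivative_def
          by (intro has_derivative_subset[OF _ sub]) auto
      qed
      then obtain z where z: "z \<in> {u<..<v}" "?h v - ?h u = D z * (v - u)" by auto
      have "v - u \<le> ?h v - ?h u"
        using expand_iterate[OF w uv(1,2)] strict_mono_onD[OF strict_mono_iterate[OF w] uv] uv(3) by auto
      then have "1 * (v - u) \<le> D z * (v - u)" using z by simp
      then have "1 \<le> D z" using uv(3) by (simp del: mult_1)
      then show ?thesis using z sub by force
    qed
    obtain z where z: "z \<in> cyl a f w" "?h y - ?h x = D z * (y - x)" "1 \<le> D z"
      using mvt[OF x y xy] by auto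
    have "cyl_hi w \<le> cyl_lo w + K / D z"
    \<comment> \<open>The right end is not in the half-open cylinder, so it is approached by points
      v inside.\<close>
    proof (rule dense_le_bounded[OF cyl_lo_less_hi[OF w]])
      fix v assume v: "cyl_lo w < v" "v < cyl_hi w"
      then have mem: "cyl_lo w \<in> cyl a f w" "v \<in> cyl a f w" by (auto simp: cyl_eq[OF w])
      obtain z' where z': "z' \<in> cyl a f w" "?h v - ?h (cyl_lo w) = D z' * (v - cyl_lo w)" "1 \<le> D z'"
        using mvt[OF mem v(1)] by auto
      have "?h v \<in> {0..<1}" "?h (cyl_lo w) \<in> {0..<1}" using image_iterate[OF w] mem by blast+
      then have "D z' * (v - cyl_lo w) \<le> 1" using z'(2) by auto
      have Dz: "D z \<le> K * D z'" using dist[OF z(1) z'(1)] z z' by (simp add: field_simps)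
      have "D z * (v - cyl_lo w) \<le> K * D z' * (v - cyl_lo w)"
        using v Dz by (intro mult_right_mono) auto
      also have "\<dots> \<le> K"
        using mult_left_mono[of "D z' * (v - cyl_lo w)" 1 K, OF \<open>D z' * (v - cyl_lo w) \<le> 1\<close>] K
        by (simp add: mult.assoc)
      finally have "D z * (v - cyl_lo w) \<le> K" .
      then show "v \<le> cyl_lo w + K / D z" using z(3) by (simp add: field_simps)
    qed
    then have "D z * len w \<le> K" using z(3) by (simp add: len_eq[OF w] field_simps)
    then have "D z * len w * (y - x) \<le> K * (y - x)" using xy by (intro mult_right_mono) auto
    moreover have "0 \<le> D z * (y - x)" using z(3) xy by simp
    with z(2) have "\<bar>?h x - ?h y\<bar> = D z * (y - x)" by linarith
    ultimately show ?thesis using xy by (simp add: mult_ac)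
  qed
  have "\<bar>(f ^^ length w) x - (f ^^ length w) y\<bar> * len w \<le> K * \<bar>x - y\<bar>"
    if "set w \<subseteq> {..<g}" "x \<in> cyl a f w" "y \<in> cyl a f w" for w x y
    using less[OF that] less[OF that(1,3,2)] by (cases x y rule: linorder_cases) (auto simp: abs_minus_commute)
  with K show ?thesis by blast
qed

text \<open>The iterate maps the child cylinder onto branch k, whose length is at least the minimum
  \<open>b\<close> of all branch lengths. As it stretches by at most \<open>K / len w\<close>, the
  child has at least the proportion \<open>b / K\<close> of its parent.\<close>

lemma len_snoc_ge:
  "\<exists>\<rho>>0. \<rho> \<le> 1 \<and> (\<forall>w k. set w \<subseteq> {..<g} \<longrightarrow> k < g \<longrightarrow> \<rho> * len w \<le> len (w @ [k]))"
proof -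
  obtain K where K: "0 < K" and lip: "\<And>w x y. set w \<subseteq> {..<g} \<Longrightarrow> x \<in> cyl a f w \<Longrightarrow> y \<in> cyl a f w \<Longrightarrow>
    \<bar>(f ^^ length w) x - (f ^^ length w) y\<bar> * len w \<le> K * \<bar>x - y\<bar>"
    using iterate_lipschitz by blast
  define b where "b = Min ((\<lambda>k. a (Suc k) - a k) ` {..<g})"
  have "b > 0" unfolding b_def using g_ge_2 a_less by (subst Min_gr_iff) (auto simp: lessThan_empty_iff)
  have b: "b \<le> a (Suc k) - a k" if "k < g" for k unfolding b_def using that by (intro Min_le) auto
  define \<rho> where "\<rho> = min 1 (b / K)"
  have "\<rho> * len w \<le> len (w @ [k])" if w: "set w \<subseteq> {..<g}" and k: "k < g" for w k
  proof -
    have wk: "set (w @ [k]) \<subseteq> {..<g}" using w k by simp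
    let ?h = "f ^^ length w"
    have inC: "\<exists>x. x \<in> cyl a f (w @ [k]) \<and> ?h x = u" if "u \<in> part_int a k" for u
    proof -
      have "u \<in> ?h ` cyl a f w" using image_iterate[OF w] part_int_subset[OF k] that by auto
      then show ?thesis using that by (auto simp: cyl_snoc)
    qed
    have "a k \<in> part_int a k" using a_less[OF k] by (simp add: part_int_def)
    then obtain x where x: "x \<in> cyl a f (w @ [k])" "?h x = a k" using inC by blast
    have "a (Suc k) \<le> a k + K * len (w @ [k]) / len w"
    \<comment> \<open>The right end of a branch is excluded as well, so values u below it are
      compared with \<open>a k\<close>.\<close>
    proof (rule dense_le_bounded[OF a_less[OF k]])
      fix u assume u: "a k < u" "u < a (Suc k)"
      then obtain y where y: "y \<in> cyl a f (w @ [k])" "?h y = u" using inC[of u] by (auto simp: part_int_def)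
      have "\<bar>?h y - ?h x\<bar> * len w \<le> K * \<bar>y - x\<bar>" using x y by (intro lip[OF w]) (auto simp: cyl_snoc)
      also have "\<dots> \<le> K * len (w @ [k])" using K abs_diff_le_len[OF wk y(1) x(1)] by simp
      finally show "u \<le> a k + K * len (w @ [k]) / len w" using u x y len_pos[OF w] by (simp add: field_simps)
    qed
    then have "(a (Suc k) - a k) * len w \<le> K * len (w @ [k])" using len_pos[OF w] by (simp add: field_simps)
    moreover have "b * len w \<le> (a (Suc k) - a k) * len w" using b[OF k] by (intro mult_right_mono) auto
    ultimately have "b / K * len w \<le> len (w @ [k])" using K by (simp add: field_simps)
    moreover have "\<rho> * len w \<le> b / K * len w" unfolding \<rho>_def by (intro mult_right_mono) auto
    ultimately show ?thesis by linarith
  qed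
  moreover have "0 < \<rho>" "\<rho> \<le> 1" using \<open>b > 0\<close> K by (auto simp: \<rho>_def)
  ultimately show ?thesis by blast
qed

section \<open>Frequency of the digit 0\<close>

lemma coding_Suc_eq_Cons: "coding x (Suc n) = digit g a f x 0 # map (\<lambda>t. digit g a f x (Suc t)) [0..<n]"
  unfolding coding_def by (rule map_upt_Suc)

lemma finite_words: "finite (words g m)"
  unfolding words_def using finite_lists_length_eq[of "{..<g}" m] by (simp add: conj_commute)

text \<open>Points with first digit 0 are sorted by the m digits that follow. Together with the same
  sorting of occurrences it reduces words of any length to the single digit 0.\<close>

lemma len_zero_split: "len [0] = (\<Sum>u\<in>words g m. len (0 # u))"
proof -
  have g0: "0 < g" using g_ge_2 by simp
  have W: "set (0 # u) \<subseteq> {..<g}" "length (0 # u) = Suc m" if "u \<in> words g m" for u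
    using that g0 by (auto simp: words_def)
  have mem: "x \<in> cyl a f (0 # u) \<longleftrightarrow> x \<in> {0..<1} \<and> coding x (Suc m) = 0 # u" if "u \<in> words g m" for x u
    using mem_cyl_iff[OF W(1)[OF that]] W(2)[OF that] by simp
  have mem0: "x \<in> cyl a f [0] \<longleftrightarrow> x \<in> {0..<1} \<and> digit g a f x 0 = 0" for x
    using mem_cyl_iff[of "[0]" x] g0 by (simp add: coding_Suc_eq_Cons)
  have "cyl a f [0] = (\<Union>u\<in>words g m. cyl a f (0 # u))"
  proof (intro set_eqI iffI)
    fix x assume "x \<in> cyl a f [0]"
    then have x: "x \<in> {0..<1}" "digit g a f x 0 = 0" by (auto simp: mem0)
    let ?u = "map (\<lambda>t. digit g a f x (Suc t)) [0..<m]"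
    have "?u \<in> words g m" using digit_less[OF x(1)] by (auto simp: words_def)
    moreover have "x \<in> cyl a f (0 # ?u)" using mem[OF \<open>?u \<in> words g m\<close>] x by (simp add: coding_Suc_eq_Cons)
    ultimately show "x \<in> (\<Union>u\<in>words g m. cyl a f (0 # u))" by blast
  qed (auto simp: mem mem0 coding_Suc_eq_Cons)
  moreover have "measure lborel (\<Union>u\<in>words g m. cyl a f (0 # u)) = (\<Sum>u\<in>words g m. len (0 # u))"
  proof (rule measure_UNION'[OF finite_words])
    show "cyl a f (0 # u) \<in> fmeasurable lborel" if "u \<in> words g m" for u
      using cyl_lo_less_hi[OF W(1)[OF that]]
      by (subst cyl_eq[OF W(1)[OF that]]) (auto simp: fmeasurable_def)
    show "pairwise (\<lambda>u v. disjnt (cyl a f (0 # u)) (cyl a f (0 # v))) (words g m)"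
      by (auto simp: pairwise_def disjnt_iff mem)
  qed
  ultimately show ?thesis by simp
qed

text \<open>Every position j that carries the digit 0 is counted for exactly one u, namely the m
  digits after j. The words \<open>0 # u\<close> have length \<open>Suc m\<close>, which gives the
  range of positions on the right.\<close>

lemma sum_tau_zero_Cons:
  assumes x: "x \<in> {0..<1}"
  shows "(\<Sum>u\<in>words g m. tau g a f (0 # u) x n) = zero_count x (n - Suc m)"
proof -
  define S where "S = {j. j < n - Suc m \<and> digit g a f x j = 0}"
  let ?u = "\<lambda>j. map (\<lambda>t. digit g a f x (j + Suc t)) [0..<m]"
  have "tau g a f (0 # u) x n = (\<Sum>j\<in>{j. j \<in> S \<and> ?u j = u}. 1)" if "u \<in> words g m" for u
  proof -
    have "length (0 # u) = Suc m" using that by (simp add: words_def)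
    then have "tau g a f (0 # u) x n = card {j. j \<in> S \<and> ?u j = u}"
      unfolding tau_def S_def by (simp only: map_upt_Suc) (auto intro: arg_cong[where f = card])
    then show ?thesis by simp
  qed
  then have "(\<Sum>u\<in>words g m. tau g a f (0 # u) x n) = (\<Sum>u\<in>words g m. \<Sum>j\<in>{j. j \<in> S \<and> ?u j = u}. 1)"
    by (intro sum.cong) auto
  also have "\<dots> = (\<Sum>j\<in>S. 1)"
  proof (rule sum.group)
    show "?u ` S \<subseteq> words g m" using digit_less[OF x] by (auto simp: words_def)
  qed (auto simp: S_def finite_words)
  finally show ?thesis by (simp add: S_def)
qed

lemma zero_frequency_if_frequencies:
  assumes x: "x \<in> {0..<1}" and lim: "\<And>u. u \<in> words g m \<Longrightarrow>
    (\<lambda>n. real (tau g a f (0 # u) x n) / real (n - Suc m)) \<longlonglongrightarrow> p (0 # u)"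
  shows "(\<lambda>N. real (zero_count x N) / real N) \<longlonglongrightarrow> (\<Sum>u\<in>words g m. p (0 # u))"
proof -
  have "(\<lambda>n. \<Sum>u\<in>words g m. real (tau g a f (0 # u) x n) / real (n - Suc m)) \<longlonglongrightarrow> (\<Sum>u\<in>words g m. p (0 # u))"
    using lim by (rule tendsto_sum)
  also have "(\<lambda>n. \<Sum>u\<in>words g m. real (tau g a f (0 # u) x n) / real (n - Suc m)) =
      (\<lambda>n. real (zero_count x (n - Suc m)) / real (n - Suc m))"
    by (simp add: sum_tau_zero_Cons[OF x, symmetric] sum_divide_distrib)
  \<comment> \<open>Putting n = N + Suc m turns the truncated difference into N.\<close>
  finally show ?thesis using LIMSEQ_ignore_initial_segment[where k = "Suc m"] by fastforce
qed

text \<open>Used in contrapositive form: a frequency of 0 that keeps away from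
  \<open>len [0]\<close> excludes m-normality for all m at once.\<close>

lemma zero_frequency_if_m_normal:
  assumes "x \<in> {0..<1}" "1 \<le> m" "m_normal g a f m x"
  shows "(\<lambda>N. real (zero_count x N) / real N) \<longlonglongrightarrow> len [0]"
proof -
  obtain m' where m: "m = Suc m'" using assms(2) by (cases m) auto
  have "(\<lambda>N. real (zero_count x N) / real N) \<longlonglongrightarrow> (\<Sum>u\<in>words g m'. len (0 # u))"
    using assms g_ge_2
    by (intro zero_frequency_if_frequencies) (auto simp: m_normal_def m words_def simp del: measure_lborel_Ico)
  then show ?thesis by (simp only: len_zero_split[of m'])
qed

lemma zero_frequency_if_freq_set:
  assumes "x \<in> freq_set g a f 1 p"
  shows "(\<lambda>N. real (zero_count x N) / real N) \<longlonglongrightarrow> p [0]"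
proof -
  have "(\<lambda>N. real (zero_count x N) / real N) \<longlonglongrightarrow> (\<Sum>u\<in>words g 0. p (0 # u))"
    using assms g_ge_2 by (intro zero_frequency_if_frequencies) (auto simp: freq_set_def words_def)
  moreover have "words g 0 = {[]}" by (auto simp: words_def)
  ultimately show ?thesis by simp
qed

lemma zero_count_add:
  assumes "x \<in> {0..<1}" shows "zero_count x (n + N) = zero_count x n + zero_count ((f ^^ n) x) N"
proof -
  have "{j. j < n + N \<and> digit g a f x j = 0} =
    {j. j < n \<and> digit g a f x j = 0} \<union> (+) n ` {j. j < N \<and> digit g a f x (n + j) = 0}" (is "?L = ?A \<union> ?B")
  proof (intro set_eqI iffI)
    fix j assume j: "j \<in> ?L"
    show "j \<in> ?A \<union> ?B"
    proof (cases "j < n")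
      case False
      then have "j = n + (j - n)" "j - n < N" using j by auto
      then show ?thesis using j by (metis (mono_tags, lifting) UnI2 image_eqI mem_Collect_eq)
    qed (use j in auto)
  qed auto
  moreover have "card (?A \<union> ?B) = card ?A + card ?B" by (rule card_Un_disjoint) auto
  moreover have "card ?B = zero_count ((f ^^ n) x) N"
    by (simp add: card_image digit_shift[OF assms])
  ultimately show ?thesis by simp
qed

text \<open>The first n digits do not influence the limit. Hence the copy of a frequency set inside
  any cylinder has the same frequency.\<close>

lemma zero_frequency_shift:
  assumes x: "x \<in> {0..<1}"
    and lim: "(\<lambda>N. real (zero_count ((f ^^ n) x) N) / real N) \<longlonglongrightarrow> q"
  shows "(\<lambda>N. real (zero_count x N) / real N) \<longlonglongrightarrow> q"
proof -
  let ?z = "\<lambda>N. real (zero_count ((f ^^ n) x) N)"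
  have c: "(\<lambda>N. c / real (N + n)) \<longlonglongrightarrow> 0" for c :: real
    using lim_const_over_n[of c] by (rule LIMSEQ_ignore_initial_segment)
  \<comment> \<open>The two summands are the shares of the first n digits and of the next N digits
    in the frequency at time N + n.\<close>
  have "(\<lambda>N. real (zero_count x n) / real (N + n) + ?z N / real N * (1 - real n / real (N + n)))
      \<longlonglongrightarrow> 0 + q * (1 - 0)"
    by (intro tendsto_intros c lim)
  moreover have "eventually (\<lambda>N. real (zero_count x n) / real (N + n) + ?z N / real N * (1 - real n / real (N + n))
      = real (zero_count x (N + n)) / real (N + n)) sequentially"
    using eventually_gt_at_top[of 0]
  proof eventually_elim
    case (elim N)
    have "1 - real n / real (N + n) = real N / real (N + n)" using elim by (simp add: field_simps)
    then show ?case using zero_count_add[OF x, of n N] elim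
      by (simp add: add.commute add_divide_distrib)
  qed
  ultimately have "(\<lambda>N. real (zero_count x (N + n)) / real (N + n)) \<longlonglongrightarrow> 0 + q * (1 - 0)"
    by (rule Lim_transform_eventually)
  from LIMSEQ_offset[OF this] show ?thesis by simp
qed

section \<open>Cylinders in intervals and contents of preimages\<close>

text \<open>Among the cylinders around the midpoint take the first one inside the interval. Its
  parent sticks out, so it has length at least half that of the interval, and a child loses at most
  the factor \<rho>.\<close>

lemma cylinder_in_interval:
  "\<exists>\<sigma>>0. \<forall>l r. 0 \<le> l \<longrightarrow> l < r \<longrightarrow> r \<le> 1 \<longrightarrow>
     (\<exists>w. set w \<subseteq> {..<g} \<and> cyl a f w \<subseteq> {l..r} \<and> \<sigma> * (r - l) \<le> len w)"
proof -
  obtain \<rho> where \<rho>: "\<rho> > 0" "\<rho> \<le> 1" "\<And>w k. set w \<subseteq> {..<g} \<Longrightarrow> k < g \<Longrightarrow> \<rho> * len w \<le> len (w @ [k])"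
    using len_snoc_ge by blast
  have "\<exists>w. set w \<subseteq> {..<g} \<and> cyl a f w \<subseteq> {l..r} \<and> \<rho> / 2 * (r - l) \<le> len w"
    if lr: "0 \<le> l" "l < r" "r \<le> 1" for l r
  proof -
    define x where "x = (l + r) / 2"
    have x: "x \<in> {0..<1}" using lr by (simp add: x_def)
    have short: "cyl a f (coding x n) \<subseteq> {l..r}" if "len (coding x n) < (r - l) / 2" for n
    proof
      fix y assume "y \<in> cyl a f (coding x n)"
      then have "\<bar>y - x\<bar> < (r - l) / 2"
        using abs_diff_le_len[OF set_coding[OF x] _ mem_cyl_coding[OF x]] that by fastforce
      then show "y \<in> {l..r}" by (auto simp: x_def abs_if field_simps split: if_splits)
    qed
    have "eventually (\<lambda>n. len (coding x n) < (r - l) / 2) sequentially"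
      using len_coding_tendsto_0[OF x] by (rule order_tendstoD) (use lr in simp)
    then obtain n0 where "len (coding x n0) < (r - l) / 2" by (auto simp: eventually_sequentially)
    then have ex: "cyl a f (coding x n0) \<subseteq> {l..r}" by (rule short)
    define n where "n = (LEAST n. cyl a f (coding x n) \<subseteq> {l..r})"
    have n: "cyl a f (coding x n) \<subseteq> {l..r}" unfolding n_def using ex by (rule LeastI)
    have "\<rho> / 2 * (r - l) \<le> len (coding x n)"
    proof (cases n)
      \<comment> \<open>There is no parent here: the cylinder is [0,1) itself, and the interval has
        length at most 1.\<close>
      case 0
      have "cyl a f [] = {0..<1}" by (auto simp: cyl_def)
      then have "len (coding x n) = 1" using 0 by (simp add: coding_def)
      moreover have "\<rho> / 2 * (r - l) \<le> 1 * 1" using \<rho> lr by (intro mult_mono) auto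
      ultimately show ?thesis by simp
    next
      case (Suc k)
      then have "\<not> cyl a f (coding x k) \<subseteq> {l..r}" using not_less_Least[of k "\<lambda>n. cyl a f (coding x n) \<subseteq> {l..r}"] by (simp add: n_def)
      then have "(r - l) / 2 \<le> len (coding x k)" using short not_less by blast
      then have "\<rho> * ((r - l) / 2) \<le> \<rho> * len (coding x k)" using \<rho> by (intro mult_left_mono) auto
      also have "\<dots> \<le> len (coding x n)" unfolding Suc coding_Suc
        using \<rho>(3) set_coding[OF x] digit_less[OF x] by blast
      finally show ?thesis by simp
    qed
    then show ?thesis using n set_coding[OF x] by blast
  qed
  then show ?thesis using \<rho>(1) by (intro exI[of _ "\<rho> / 2"]) auto
qed

text \<open>A cover of the copy, restricted to the cylinder and mapped forward by the iterate,
  covers \<open>G\<close>, and diameters grow at most by the factor \<open>K / len w\<close>. This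
  gives the constant \<open>\<kappa> / K powr t\<close>, the same for all cylinders.\<close>

lemma content_ge_preimage:
  assumes G: "content_ge t G \<kappa>" "G \<subseteq> {0..<1}" and pos: "0 < \<kappa>" "0 < t"
  shows "\<exists>\<gamma>>0. \<forall>w. set w \<subseteq> {..<g} \<longrightarrow>
    content_ge t {x \<in> cyl a f w. (f ^^ length w) x \<in> G} (\<gamma> * len w powr t)"
proof -
  obtain K where K: "0 < K" and lip: "\<And>w x y. set w \<subseteq> {..<g} \<Longrightarrow> x \<in> cyl a f w \<Longrightarrow> y \<in> cyl a f w \<Longrightarrow>
    \<bar>(f ^^ length w) x - (f ^^ length w) y\<bar> * len w \<le> K * \<bar>x - y\<bar>"
    using iterate_lipschitz by blast
  have "content_ge t {x \<in> cyl a f w. (f ^^ length w) x \<in> G} (\<kappa> / K powr t * len w powr t)"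
    if w: "set w \<subseteq> {..<g}" for w
    unfolding content_ge_def
  proof (intro allI impI, elim conjE)
    fix U :: "nat \<Rightarrow> real set" and d B
    let ?h = "f ^^ length w"
    assume U: "{x \<in> cyl a f w. ?h x \<in> G} \<subseteq> (\<Union>j. U j)" and d: "\<forall>j. 0 \<le> d j"
      and diam: "\<forall>j. \<forall>x\<in>U j. \<forall>y\<in>U j. \<bar>x - y\<bar> \<le> d j" 
      and B: "\<forall>F. finite F \<longrightarrow> (\<Sum>j\<in>F. d j powr t) \<le> B"
    define c where "c = K / len w"
    have c: "c > 0" using K len_pos[OF w] by (simp add: c_def)
    have "\<kappa> \<le> c powr t * B"
    proof (rule content_geD[OF G(1), of "\<lambda>j. ?h ` (U j \<inter> cyl a f w)" UNIV "\<lambda>j. c * d j"])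
      show "G \<subseteq> (\<Union>j\<in>UNIV. ?h ` (U j \<inter> cyl a f w))"
      proof
        fix y assume y: "y \<in> G"
        then have "y \<in> ?h ` cyl a f w" using G(2) image_iterate[OF w] by blast
        then show "y \<in> (\<Union>j\<in>UNIV. ?h ` (U j \<inter> cyl a f w))" using y U by blast
      qed
      show "0 \<le> c * d j" for j using c d by simp
      show "\<bar>x - y\<bar> \<le> c * d j" if xy: "x \<in> ?h ` (U j \<inter> cyl a f w)" "y \<in> ?h ` (U j \<inter> cyl a f w)" for j x y
      proof -
        obtain u v where uv: "u \<in> U j" "v \<in> U j" "u \<in> cyl a f w" "v \<in> cyl a f w" "x = ?h u" "y = ?h v"
          using xy by blast
        have "\<bar>x - y\<bar> * len w \<le> K * \<bar>u - v\<bar>" using lip[OF w uv(3,4)] uv by simp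
        also have "\<dots> \<le> K * d j" using diam uv K by simp
        finally have "\<bar>x - y\<bar> \<le> K * d j / len w" using len_pos[OF w] by (simp add: pos_le_divide_eq)
        then show ?thesis by (simp add: c_def)
      qed
      show "(\<Sum>j\<in>F. (c * d j) powr t) \<le> c powr t * B" if "finite F" "F \<subseteq> UNIV" for F
      proof -
        have "(\<Sum>j\<in>F. (c * d j) powr t) = c powr t * (\<Sum>j\<in>F. d j powr t)"
          using c d by (simp add: powr_mult sum_distrib_left)
        also have "\<dots> \<le> c powr t * B" using B that by (intro mult_left_mono) auto
        finally show ?thesis .
      qed
    qed
    moreover have "c powr t = K powr t / len w powr t"
      unfolding c_def by (rule powr_divide)
    ultimately show "\<kappa> / K powr t * len w powr t \<le> B"
      using K len_pos[OF w] by (simp add: field_simps)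
  qed
  then show ?thesis using pos K by (intro exI[of _ "\<kappa> / K powr t"]) auto
qed

end

section \<open>Sparse intervals\<close>

definition sparse :: "(nat \<Rightarrow> real) \<Rightarrow> (nat \<Rightarrow> real) \<Rightarrow> real \<Rightarrow> real \<Rightarrow> real \<Rightarrow> real \<Rightarrow> bool" where
  "sparse p e s \<epsilon> l r \<longleftrightarrow> (\<forall>F. finite F \<longrightarrow> (\<forall>j\<in>F. {p j..p j + e j} \<inter> {l..r} \<noteq> {}) \<longrightarrow>
     (\<Sum>j\<in>F. e j powr s) \<le> \<epsilon> * (r - l) powr s)"

lemma sparse_mono: "sparse p e s \<epsilon> l r \<Longrightarrow> \<epsilon> \<le> \<epsilon>' \<Longrightarrow> sparse p e s \<epsilon>' l r"
  unfolding sparse_def by (meson mult_right_mono order_trans powr_ge_zero)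

text \<open>Exchange the sums and count how often each j occurs; the constant 2 comes from the two
  endpoints of an interval.\<close>

lemma sum_subinterval_powr_le:
  fixes p e :: "nat \<Rightarrow> real" and lo hi :: "'i \<Rightarrow> real"
  assumes e: "\<And>j. 0 < e j" and V: "finite V"
    and disj: "\<And>u v x. u \<in> V \<Longrightarrow> v \<in> V \<Longrightarrow> x \<in> {lo u..<hi u} \<Longrightarrow> x \<in> {lo v..<hi v} \<Longrightarrow> u = v"
    and F: "\<And>v. v \<in> V \<Longrightarrow> finite (F v)"
      "\<And>v j. v \<in> V \<Longrightarrow> j \<in> F v \<Longrightarrow> {p j..p j + e j} \<inter> {lo v..<hi v} \<noteq> {} \<and> e j < hi v - lo v"
    and B: "(\<Sum>j\<in>(\<Union>v\<in>V. F v). e j powr s) \<le> B"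
  shows "(\<Sum>v\<in>V. \<Sum>j\<in>F v. e j powr s) \<le> 2 * B"
proof -
  define J where "J = (\<Union>v\<in>V. F v)"
  have J: "finite J" using V F by (simp add: J_def)
  have card: "card {v \<in> V. j \<in> F v} \<le> 2" for j
  proof -
    \<comment> \<open>an interval longer than [e j] meeting [p j, p j + e j] contains one of its endpoints\<close>
    have "{v \<in> V. j \<in> F v} \<subseteq> {v \<in> V. p j \<in> {lo v..<hi v}} \<union> {v \<in> V. p j + e j \<in> {lo v..<hi v}}"
      (is "_ \<subseteq> ?A \<union> ?B")
      using F(2) by fastforce
    then have "card {v \<in> V. j \<in> F v} \<le> card (?A \<union> ?B)" using V by (intro card_mono) auto
    also have "\<dots> \<le> card ?A + card ?B" by (rule card_Un_le)
    also have "\<dots> \<le> Suc 0 + Suc 0"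
    proof (rule add_mono)
      show "card ?A \<le> Suc 0" by (subst card_le_Suc0_iff_eq) (use V disj in auto)
      show "card ?B \<le> Suc 0" by (subst card_le_Suc0_iff_eq) (use V disj in auto)
    qed
    finally show ?thesis by simp
  qed
  have "(\<Sum>v\<in>V. \<Sum>j\<in>F v. e j powr s) = (\<Sum>v\<in>V. \<Sum>j\<in>{j \<in> J. j \<in> F v}. e j powr s)"
    by (intro sum.cong) (auto simp: J_def)
  also have "\<dots> = (\<Sum>j\<in>J. \<Sum>v\<in>{v \<in> V. j \<in> F v}. e j powr s)"
    by (rule sum.swap_restrict[OF V J])
  also have "\<dots> \<le> (\<Sum>j\<in>J. 2 * e j powr s)"
  proof (rule sum_mono)
    fix j
    have "real (card {v \<in> V. j \<in> F v}) * e j powr s \<le> 2 * e j powr s"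
      using card[of j] by (intro mult_right_mono) auto
    then show "(\<Sum>v\<in>{v \<in> V. j \<in> F v}. e j powr s) \<le> 2 * e j powr s" by simp
  qed
  also have "\<dots> \<le> 2 * B" using B by (simp add: sum_distrib_left[symmetric] J_def)
  finally show ?thesis .
qed

text \<open>Each single term satisfies \<open>e j powr s \<le> M\<close>, so raising the exponent to
  t costs at most the factor \<open>M powr ((t - s) / s)\<close>.\<close>

lemma sum_powr_le:
  fixes e :: "'i \<Rightarrow> real"
  assumes "0 < s" "s < t" "\<And>j. j \<in> J \<Longrightarrow> 0 < e j" "finite J" "(\<Sum>j\<in>J. e j powr s) \<le> M" 
  shows "(\<Sum>j\<in>J. e j powr t) \<le> M powr (t / s)"
proof (cases "J = {}")
  case False
  have M: "e j powr s \<le> M" if "j \<in> J" for j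
    using member_le_sum[OF that, of "\<lambda>j. e j powr s"] assms by simp
  have Mpos: "0 < M" using False M assms(3) by (metis all_not_in_conv order.strict_trans2 powr_gt_zero less_irrefl)
  have "e j powr t \<le> e j powr s * M powr ((t - s) / s)" if "j \<in> J" for j
  proof -
    have "e j powr t = e j powr s * (e j powr s) powr ((t - s) / s)"
      using assms by (simp add: powr_powr powr_add[symmetric])
    also have "\<dots> \<le> e j powr s * M powr ((t - s) / s)"
      using M[OF that] assms by (intro mult_left_mono powr_mono2) auto
    finally show ?thesis .
  qed
  then have "(\<Sum>j\<in>J. e j powr t) \<le> (\<Sum>j\<in>J. e j powr s) * M powr ((t - s) / s)"
    unfolding sum_distrib_right by (rule sum_mono)
  also have "\<dots> \<le> M powr 1 * M powr ((t - s) / s)"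
    using assms Mpos by (intro mult_right_mono) auto
  also have "\<dots> = M powr (t / s)"
    using assms by (simp only: powr_add[symmetric]) (simp add: field_simps)
  finally show ?thesis .
qed simp

text \<open>L is the length of the parent cylinder and \<theta> bounds the relative size of the
  pieces. If no piece had a sparse left half, \<open>A\<close> would be covered by long pieces and
  tripled intervals. The first smallness condition bounds the tripled intervals, the second the long
  pieces, each by a quarter of the content.\<close>

lemma exists_sparse_subinterval:
  fixes p e :: "nat \<Rightarrow> real" and lo hi :: "'i::countable \<Rightarrow> real"
  assumes st: "0 < s" "s < t" "t \<le> 1" and L: "0 < L" and \<gamma>: "0 < \<gamma>"
    and content: "content_ge t A (\<gamma> * L powr t)"
    and cov: "A \<subseteq> (\<Union>v\<in>V. {lo v..<hi v})"
    and lohi: "\<And>v. v \<in> V \<Longrightarrow> lo v < hi v" "\<And>v. v \<in> V \<Longrightarrow> hi v - lo v \<le> \<theta> * L"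
    and disj: "\<And>u v x. u \<in> V \<Longrightarrow> v \<in> V \<Longrightarrow> x \<in> {lo u..<hi u} \<Longrightarrow> x \<in> {lo v..<hi v} \<Longrightarrow> u = v"
    and e: "\<And>j. 0 < e j"
    and sum_le: "\<And>F. finite F \<Longrightarrow> (\<And>j. j \<in> F \<Longrightarrow> \<exists>v\<in>V. {p j..p j + e j} \<inter> {lo v..<hi v} \<noteq> {}) \<Longrightarrow>
       (\<Sum>j\<in>F. e j powr s) \<le> \<epsilon> * L powr s"
    and pos: "0 < \<epsilon>" "0 < \<epsilon>'" "0 < \<theta>"
    and small: "3 powr t * \<epsilon> powr (t / s) \<le> \<gamma> / 4" "4 * \<epsilon> / \<epsilon>' * \<theta> powr (t - s) \<le> \<gamma> / 4"
  shows "\<exists>v\<in>V. sparse p e s \<epsilon>' (lo v) ((lo v + hi v) / 2)"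
proof (rule ccontr)
  assume none: "\<not> ?thesis"
  let ?M = "\<lambda>j v. {p j..p j + e j} \<inter> {lo v..<hi v} \<noteq> {}"
  have "\<exists>F. finite F \<and> (\<forall>j\<in>F. ?M j v) \<and> \<epsilon>' / 2 * (hi v - lo v) powr s \<le> (\<Sum>j\<in>F. e j powr s)"
    if v: "v \<in> V" for v
  proof -
    obtain F where F: "finite F" "\<forall>j\<in>F. {p j..p j + e j} \<inter> {lo v..(lo v + hi v) / 2} \<noteq> {}"
      "\<epsilon>' * ((lo v + hi v) / 2 - lo v) powr s < (\<Sum>j\<in>F. e j powr s)"
      using none v unfolding sparse_def by (force simp: not_le)
    \<comment> \<open>Sparsity is tested on the closed left half; an interval meeting it also meets
      the half-open piece.\<close>
    have "{lo v..(lo v + hi v) / 2} \<subseteq> {lo v..<hi v}" using lohi(1)[OF v] by auto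
    then have "\<forall>j\<in>F. ?M j v" using F(2) by blast
    moreover have "\<epsilon>' / 2 * (hi v - lo v) powr s \<le> \<epsilon>' * ((lo v + hi v) / 2 - lo v) powr s"
    proof -
      have eq: "(lo v + hi v) / 2 - lo v = (hi v - lo v) / 2" by (simp add: field_simps)
      \<comment> \<open>Passing from the half to the whole piece costs \<open>2 powr s\<close>, at
        most 2 since s is below 1; hence \<open>\<epsilon>' / 2\<close>.\<close>
      have "(2::real) powr s \<le> 2 powr 1" using st by (intro powr_mono) auto
      then have "(hi v - lo v) powr s / 2 \<le> (hi v - lo v) powr s / 2 powr s" by (intro divide_left_mono) auto
      also have "\<dots> = ((hi v - lo v) / 2) powr s" using lohi(1)[OF v] by (simp add: powr_divide)
      finally have "\<epsilon>' * ((hi v - lo v) powr s / 2) \<le> \<epsilon>' * ((hi v - lo v) / 2) powr s"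
        using pos by (intro mult_left_mono) auto
      then show ?thesis unfolding eq by simp
    qed
    ultimately show ?thesis using F by (intro exI[of _ F]) linarith
  qed
  then obtain F where F: "\<And>v. v \<in> V \<Longrightarrow> finite (F v)" "\<And>v j. v \<in> V \<Longrightarrow> j \<in> F v \<Longrightarrow> ?M j v"
    "\<And>v. v \<in> V \<Longrightarrow> \<epsilon>' / 2 * (hi v - lo v) powr s \<le> (\<Sum>j\<in>F v. e j powr s)"
    by metis
  \<comment> \<open>Pieces longer than every interval they meet; for these an interval is counted at
    most twice. The other pieces are absorbed by tripled intervals.\<close>
  define V' where "V' = {v \<in> V. \<forall>j. ?M j v \<longrightarrow> e j < hi v - lo v}"
  define J' where "J' = {j. \<exists>v\<in>V. ?M j v}"
  have sumV: "(\<Sum>v\<in>W. (hi v - lo v) powr t) \<le> \<gamma> / 4 * L powr t" if W: "finite W" "W \<subseteq> V'" for W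
  proof -
    have WV: "v \<in> V" if "v \<in> W" for v using W that by (auto simp: V'_def)
    have "(\<Sum>v\<in>W. \<Sum>j\<in>F v. e j powr s) \<le> 2 * (\<epsilon> * L powr s)"
    proof (rule sum_subinterval_powr_le[OF e W(1)])
      show "(\<Sum>j\<in>(\<Union>v\<in>W. F v). e j powr s) \<le> \<epsilon> * L powr s"
        using W(1) WV F(1,2) by (intro sum_le) blast+
      show "u = v" if "u \<in> W" "v \<in> W" "x \<in> {lo u..<hi u}" "x \<in> {lo v..<hi v}" for u v x
        using disj[OF WV WV] that by blast
      show "finite (F v)" if "v \<in> W" for v using F(1)[OF WV[OF that]] .
      show "?M j v \<and> e j < hi v - lo v" if "v \<in> W" "j \<in> F v" for v j
        using F(2)[OF WV[OF that(1)] that(2)] W(2) that(1) unfolding V'_def by blast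
    qed
    moreover have "\<epsilon>' / 2 * (\<Sum>v\<in>W. (hi v - lo v) powr s) \<le> (\<Sum>v\<in>W. \<Sum>j\<in>F v. e j powr s)"
      unfolding sum_distrib_left by (intro sum_mono F(3) WV)
    ultimately have W_s: "(\<Sum>v\<in>W. (hi v - lo v) powr s) \<le> 4 * \<epsilon> / \<epsilon>' * L powr s"
      using pos by (simp add: field_simps)
    \<comment> \<open>The gain from t > s: a piece of length at most \<open>\<theta> * L\<close>
      contributes the extra factor \<open>(\<theta> * L) powr (t - s)\<close>, small for small
      \<theta>.\<close>
    have "(\<Sum>v\<in>W. (hi v - lo v) powr t) \<le> (\<Sum>v\<in>W. (hi v - lo v) powr s * (\<theta> * L) powr (t - s))"
    proof (rule sum_mono)
      fix v assume v: "v \<in> W"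
      have "(hi v - lo v) powr t = (hi v - lo v) powr s * (hi v - lo v) powr (t - s)"
        by (simp add: powr_add[symmetric])
      also have "\<dots> \<le> (hi v - lo v) powr s * (\<theta> * L) powr (t - s)"
        using lohi[OF WV[OF v]] st by (intro mult_left_mono powr_mono2) auto
      finally show "(hi v - lo v) powr t \<le> (hi v - lo v) powr s * (\<theta> * L) powr (t - s)" .
    qed
    also have "\<dots> \<le> 4 * \<epsilon> / \<epsilon>' * L powr s * (\<theta> * L) powr (t - s)"
      unfolding sum_distrib_right[symmetric] using W_s by (intro mult_right_mono) auto
    also have "\<dots> = 4 * \<epsilon> / \<epsilon>' * \<theta> powr (t - s) * (L powr s * L powr (t - s))"
      using pos L by (simp add: powr_mult)
    also have "\<dots> = 4 * \<epsilon> / \<epsilon>' * \<theta> powr (t - s) * L powr t"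
      by (simp add: powr_add[symmetric])
    also have "\<dots> \<le> \<gamma> / 4 * L powr t" using small by (intro mult_right_mono) auto
    finally show ?thesis .
  qed
  have sumJ: "(\<Sum>j\<in>J. (3 * e j) powr t) \<le> \<gamma> / 4 * L powr t" if J: "finite J" "J \<subseteq> J'" for J
  proof -
    have "(\<Sum>j\<in>J. e j powr t) \<le> (\<epsilon> * L powr s) powr (t / s)"
      using st e J by (intro sum_powr_le sum_le) (auto simp: J'_def)
    also have "\<dots> = \<epsilon> powr (t / s) * L powr t"
      using pos st by (simp add: powr_mult powr_powr)
    finally have "3 powr t * (\<Sum>j\<in>J. e j powr t) \<le> 3 powr t * (\<epsilon> powr (t / s) * L powr t)"
      by (intro mult_left_mono) auto
    also have "\<dots> \<le> \<gamma> / 4 * L powr t"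
      unfolding mult.assoc[symmetric] using small by (intro mult_right_mono) auto
    finally show ?thesis using e by (simp add: powr_mult sum_distrib_left less_imp_le)
  qed
  define U where "U = case_sum (\<lambda>v. {lo v..<hi v}) (\<lambda>j. {p j - e j..p j + 2 * e j})"
  define d where "d = case_sum (\<lambda>v. hi v - lo v) (\<lambda>j. 3 * e j)"
  have "\<gamma> * L powr t \<le> \<gamma> / 2 * L powr t"
  proof (rule content_geD[OF content, of U "V' <+> J'" d])
    show "A \<subseteq> (\<Union>z\<in>V' <+> J'. U z)"
    proof
      fix x assume "x \<in> A"
      then obtain v where v: "v \<in> V" "x \<in> {lo v..<hi v}" using cov by blast
      show "x \<in> (\<Union>z\<in>V' <+> J'. U z)"
      proof (cases "v \<in> V'")
        case True
        then show ?thesis using v by (intro UN_I[of "Inl v"]) (auto simp: U_def)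
      next
        case False
        then obtain j where j: "?M j v" "hi v - lo v \<le> e j" using v by (auto simp: V'_def not_less)
        then obtain y where "y \<in> {p j..p j + e j}" "y \<in> {lo v..<hi v}" by blast
        \<comment> \<open>The piece is no longer than \<open>e j\<close> and meets the interval, so
          it stays within distance \<open>e j\<close> of it.\<close>
        then have "x \<in> {p j - e j..p j + 2 * e j}" using v(2) j(2) by auto
        moreover have "j \<in> J'" using j(1) v(1) by (auto simp: J'_def)
        ultimately show ?thesis by (intro UN_I[of "Inr j"]) (auto simp: U_def)
      qed
    qed
    show "0 \<le> d z" if "z \<in> V' <+> J'" for z
      using that lohi(1) e by (auto simp: d_def V'_def less_imp_le)
    show "\<bar>x - y\<bar> \<le> d z" if "z \<in> V' <+> J'" "x \<in> U z" "y \<in> U z" for z x y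
      using that by (auto simp: U_def d_def)
    show "(\<Sum>z\<in>Z. d z powr t) \<le> \<gamma> / 2 * L powr t" if Z: "finite Z" "Z \<subseteq> V' <+> J'" for Z
    proof -
      have fin: "finite (Inl -` Z)" "finite (Inr -` Z)" using Z(1) by (auto intro: finite_vimageI)
      have "Z = (Inl -` Z) <+> (Inr -` Z)"
      proof (intro set_eqI)
        fix z show "z \<in> Z \<longleftrightarrow> z \<in> (Inl -` Z) <+> (Inr -` Z)" by (cases z) auto
      qed
      then have "(\<Sum>z\<in>Z. d z powr t) = (\<Sum>z\<in>(Inl -` Z) <+> (Inr -` Z). d z powr t)" by simp
      also have "\<dots> = (\<Sum>v\<in>Inl -` Z. (hi v - lo v) powr t) + (\<Sum>j\<in>Inr -` Z. (3 * e j) powr t)"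
        using fin by (subst sum.Plus) (auto simp: d_def)
      also have "\<dots> \<le> \<gamma> / 4 * L powr t + \<gamma> / 4 * L powr t"
        using Z(2) by (intro add_mono sumV sumJ fin) auto
      finally show ?thesis by simp
    qed
  qed
  moreover have "0 < L powr t" using L by simp
  ultimately show False using \<gamma> by (simp add: mult_le_cancel_right)
qed

section \<open>Refining a sparse interval for one map\<close>

context expanding_map
begin

text \<open>The order of quantifiers matters: \<epsilon> and \<eta> depend on the map and its
  frequency set but not on the target level \<open>\<epsilon>'\<close>, the cover, the interval or
  k. The new interval can therefore be as sparse as the map treated next requires.\<close>

lemma sparse_deviating_subinterval:
  assumes st: "0 < s" "s < t" "t \<le> 1" and G: "content_ge t G \<kappa>" "0 < \<kappa>" "G \<subseteq> {0..<1}"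
    and freq: "\<And>y. y \<in> G \<Longrightarrow> (\<lambda>N. real (zero_count y N) / real N) \<longlonglongrightarrow> q" and qc: "q \<noteq> c"
  shows "\<exists>\<epsilon>>0. \<exists>\<eta>>0. \<forall>\<epsilon>'>0. \<forall>p e l r k. (\<forall>j. 0 < e j) \<longrightarrow> 0 \<le> l \<longrightarrow> l < r \<longrightarrow> r < 1 \<longrightarrow> sparse p e s \<epsilon> l r \<longrightarrow>
    (\<exists>l' r'. l \<le> l' \<and> l' < r' \<and> r' \<le> r \<and> sparse p e s \<epsilon>' l' r' \<and>
      (\<exists>N\<ge>k. \<forall>x\<in>{l'..r'}. \<eta> < \<bar>real (zero_count x N) / real N - c\<bar>))"
proof -
  have t0: "0 < t" using st by simp
  obtain \<gamma> where \<gamma>: "\<gamma> > 0" "\<And>w. set w \<subseteq> {..<g} \<Longrightarrow>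
      content_ge t {x \<in> cyl a f w. (f ^^ length w) x \<in> G} (\<gamma> * len w powr t)"
    using content_ge_preimage[OF G(1,3,2) t0] by blast
  obtain \<sigma> where \<sigma>: "\<sigma> > 0" "\<And>l r. 0 \<le> l \<Longrightarrow> l < r \<Longrightarrow> r \<le> 1 \<Longrightarrow>
     \<exists>w. set w \<subseteq> {..<g} \<and> cyl a f w \<subseteq> {l..r} \<and> \<sigma> * (r - l) \<le> len w"
    using cylinder_in_interval by blast
  \<comment> \<open>The solution of
    \<open>3 powr t * \<epsilon>1 powr (t / s) = \<gamma> / 4\<close>.\<close>
  define \<epsilon>1 where "\<epsilon>1 = (\<gamma> / (4 * 3 powr t)) powr (s / t)"
  have \<epsilon>1: "\<epsilon>1 > 0" "3 powr t * \<epsilon>1 powr (t / s) \<le> \<gamma> / 4"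
    using \<gamma>(1) st by (auto simp: \<epsilon>1_def powr_powr)
  \<comment> \<open>The factor \<open>\<sigma> powr s\<close> converts sparsity relative to r - l
    into sparsity relative to the length of the cylinder found inside.\<close>
  define \<epsilon> where "\<epsilon> = \<epsilon>1 * \<sigma> powr s"
  define \<eta> where "\<eta> = \<bar>q - c\<bar> / 2"
  have "\<exists>l' r'. l \<le> l' \<and> l' < r' \<and> r' \<le> r \<and> sparse p e s \<epsilon>' l' r' \<and>
      (\<exists>N\<ge>k. \<forall>x\<in>{l'..r'}. \<eta> < \<bar>real (zero_count x N) / real N - c\<bar>)"
    if \<epsilon>': "\<epsilon>' > 0" and e: "\<forall>j. 0 < e j" and lr: "0 \<le> l" "l < r" "r < 1" and sp: "sparse p e s \<epsilon> l r"
    for \<epsilon>' l r and p e :: "nat \<Rightarrow> real" and k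
  proof -
    \<comment> \<open>The solution of \<open>4 * \<epsilon>1 / \<epsilon>' * \<theta> powr (t - s) =
      \<gamma> / 4\<close>; only this constant depends on \<open>\<epsilon>'\<close>.\<close>
    define \<theta> where "\<theta> = (\<gamma> * \<epsilon>' / (16 * \<epsilon>1)) powr (1 / (t - s))"
    have \<theta>: "\<theta> > 0" "4 * \<epsilon>1 / \<epsilon>' * \<theta> powr (t - s) \<le> \<gamma> / 4"
      using \<gamma>(1) \<epsilon>' \<epsilon>1(1) st by (auto simp: \<theta>_def powr_powr)
    obtain w where w: "set w \<subseteq> {..<g}" "cyl a f w \<subseteq> {l..r}" "\<sigma> * (r - l) \<le> len w"
      using \<sigma>(2)[of l r] lr by auto
    define n where "n = length w"
    define A where "A = {x \<in> cyl a f w. (f ^^ n) x \<in> G}"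
    \<comment> \<open>The stopping condition. It depends only on the first N digits, and n \<le> N
      puts the stopped cylinder inside the cylinder of \<open>w\<close>.\<close>
    define P where "P x N \<longleftrightarrow> coding x n = w \<and> n \<le> N \<and> k \<le> N \<and> len (coding x N) \<le> \<theta> * len w \<and>
      \<eta> < \<bar>real (zero_count x N) / real N - c\<bar>" for x N
    have P_cong: "P y N" if "P x N" "coding x N = coding y N" for x y N
    proof -
      have "coding y n = coding x n" using that take_coding[of n N x] take_coding[of n N y] by (simp add: P_def)
      then show ?thesis using that zero_count_cong[OF that(2)] by (simp add: P_def)
    qed
    have A01: "x \<in> {0..<1}" if "x \<in> A" for x using that mem_cyl_iff[OF w(1)] by (simp add: A_def)
    have exP: "\<exists>N. P x N" if x: "x \<in> A" for x
    proof -
      have x01: "x \<in> {0..<1}" using A01[OF x] .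
      have "(\<lambda>N. real (zero_count x N) / real N) \<longlonglongrightarrow> q"
        using x by (intro zero_frequency_shift[OF x01, of n] freq) (simp add: A_def)
      then have "(\<lambda>N. \<bar>real (zero_count x N) / real N - c\<bar>) \<longlonglongrightarrow> \<bar>q - c\<bar>"
        by (intro tendsto_intros)
      then have "eventually (\<lambda>N. \<eta> < \<bar>real (zero_count x N) / real N - c\<bar>) sequentially"
        by (rule order_tendstoD) (use qc in \<open>simp add: \<eta>_def\<close>)
      moreover have "eventually (\<lambda>N. len (coding x N) < \<theta> * len w) sequentially"
        using len_coding_tendsto_0[OF x01] by (rule order_tendstoD) (use \<theta> len_pos[OF w(1)] in simp)
      ultimately have "eventually (P x) sequentially"
        using eventually_ge_at_top[of n] eventually_ge_at_top[of k]
      proof eventually_elim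
        case (elim N)
        have "coding x n = w" using x mem_cyl_iff[OF w(1)] by (simp add: A_def n_def)
        then show ?case using elim by (simp add: P_def)
      qed
      then show ?thesis by (auto simp: eventually_sequentially)
    qed
    \<comment> \<open>Stopping at the first admissible time makes the stopped cylinders pairwise
      disjoint.\<close>
    define T where "T x = (LEAST N. P x N)" for x
    have T: "P x (T x)" if "x \<in> A" for x unfolding T_def using exP[OF that] by (rule LeastI_ex)
    have T_le: "T x \<le> N" if "P x N" for x N unfolding T_def using that by (rule Least_le)
    define V where "V = (\<lambda>x. coding x (T x)) ` A"
    have V: "set v \<subseteq> {..<g}" if "v \<in> V" for v using that set_coding A01 by (auto simp: V_def)
    note cv = cyl_eq[OF V, symmetric]
    \<comment> \<open>If two stopped cylinders share z, the shorter word is a prefix of the longer,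
      so y satisfies the condition already at time \<open>T x\<close> and minimality forces equal
      times.\<close>
    have le_agree: "coding x (T x) = coding y (T y)"
      if "x \<in> A" "y \<in> A" "coding z (T x) = coding x (T x)" "coding z (T y) = coding y (T y)" "T x \<le> T y" for x y z
    proof -
      have "coding x (T x) = coding y (T x)" using that take_coding[OF that(5)] by metis
      then have "P y (T x)" using P_cong T that(1) by blast
      then have "T y = T x" using T_le that(5) by fastforce
      then show ?thesis using \<open>coding x (T x) = coding y (T x)\<close> by simp
    qed
    have disj: "u = v" if uv: "u \<in> V" "v \<in> V" and z: "z \<in> cyl a f u" "z \<in> cyl a f v" for u v z
    proof -
      obtain x y where xy: "x \<in> A" "y \<in> A" "u = coding x (T x)" "v = coding y (T y)"
        using uv by (auto simp: V_def)
      have "coding z (T x) = coding x (T x)" "coding z (T y) = coding y (T y)"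
        using z mem_cyl_iff V uv xy by auto
      then show ?thesis using le_agree[OF xy(1,2)] le_agree[OF xy(2,1)] xy(3,4) by (metis nle_le)
    qed
    have Vw: "cyl a f v \<subseteq> cyl a f w" if v: "v \<in> V" for v
    proof
      fix z assume z: "z \<in> cyl a f v"
      obtain x where x: "x \<in> A" "v = coding x (T x)" using v by (auto simp: V_def)
      then have z': "z \<in> {0..<1}" "coding z (T x) = coding x (T x)" using z mem_cyl_iff[OF V[OF v]] by auto
      then have "P z (T x)" using P_cong[OF T[OF x(1)]] by simp
      then show "z \<in> cyl a f w" using z' mem_cyl_iff[OF w(1)] by (simp add: P_def n_def)
    qed
    have "\<exists>v\<in>V. sparse p e s \<epsilon>' (cyl_lo v) ((cyl_lo v + cyl_hi v) / 2)"
    proof (rule exists_sparse_subinterval[OF st len_pos[OF w(1)] \<gamma>(1)])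
      show "content_ge t A (\<gamma> * len w powr t)" using \<gamma>(2)[OF w(1)] by (simp add: A_def n_def)
      show "A \<subseteq> (\<Union>v\<in>V. {cyl_lo v..<cyl_hi v})"
      proof
        fix x assume x: "x \<in> A"
        then have "coding x (T x) \<in> V" by (simp add: V_def)
        moreover from this have "x \<in> {cyl_lo (coding x (T x))..<cyl_hi (coding x (T x))}"
          using mem_cyl_coding[OF A01[OF x]] cv by blast
        ultimately show "x \<in> (\<Union>v\<in>V. {cyl_lo v..<cyl_hi v})" by blast
      qed
      show "cyl_lo v < cyl_hi v" if "v \<in> V" for v using cyl_lo_less_hi[OF V[OF that]] .
      show "cyl_hi v - cyl_lo v \<le> \<theta> * len w" if v: "v \<in> V" for v
      proof -
        have "len v \<le> \<theta> * len w" using v T by (auto simp: V_def P_def)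
        then show ?thesis by (simp only: len_eq[OF V[OF v]])
      qed
      show "u = v" if "u \<in> V" "v \<in> V" "x \<in> {cyl_lo u..<cyl_hi u}" "x \<in> {cyl_lo v..<cyl_hi v}" for u v x
        using that(3,4) unfolding cv[OF that(1)] cv[OF that(2)] by (rule disj[OF that(1,2)])
      show "0 < e j" for j using e by blast
      show "(\<Sum>j\<in>F. e j powr s) \<le> \<epsilon>1 * len w powr s"
        if F: "finite F" "\<And>j. j \<in> F \<Longrightarrow> \<exists>v\<in>V. {p j..p j + e j} \<inter> {cyl_lo v..<cyl_hi v} \<noteq> {}" for F
      proof -
        have "{p j..p j + e j} \<inter> {l..r} \<noteq> {}" if j: "j \<in> F" for j
        proof -
          obtain v where v: "v \<in> V" "{p j..p j + e j} \<inter> {cyl_lo v..<cyl_hi v} \<noteq> {}" using F(2)[OF j] by blast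
          have "{cyl_lo v..<cyl_hi v} \<subseteq> {l..r}" using Vw[OF v(1)] w(2) unfolding cv[OF v(1)] by blast
          then show ?thesis using v(2) by blast
        qed
        then have "(\<Sum>j\<in>F. e j powr s) \<le> \<epsilon> * (r - l) powr s" using sp F(1) unfolding sparse_def by blast
        also have "\<dots> = \<epsilon>1 * (\<sigma> * (r - l)) powr s" using \<sigma>(1) lr by (simp add: \<epsilon>_def powr_mult)
        also have "\<dots> \<le> \<epsilon>1 * len w powr s"
          using \<epsilon>1 \<sigma>(1) lr w(3) st by (intro mult_left_mono powr_mono2) auto
        finally show ?thesis .
      qed
    qed (use \<epsilon>1 \<theta> \<epsilon>' in auto)
    then obtain v where v: "v \<in> V" "sparse p e s \<epsilon>' (cyl_lo v) ((cyl_lo v + cyl_hi v) / 2)" by blast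
    let ?r = "(cyl_lo v + cyl_hi v) / 2"
    have lh: "cyl_lo v < cyl_hi v" using cyl_lo_less_hi[OF V[OF v(1)]] .
    have sub: "{cyl_lo v..?r} \<subseteq> cyl a f v" unfolding cyl_eq[OF V[OF v(1)]] using lh by auto
    then have "{cyl_lo v..?r} \<subseteq> {l..r}" using Vw[OF v(1)] w(2) by blast
    then have ends: "l \<le> cyl_lo v" "?r \<le> r" using lh by auto
    obtain x where x: "x \<in> A" "v = coding x (T x)" using v(1) by (auto simp: V_def)
    have "\<eta> < \<bar>real (zero_count y (T x)) / real (T x) - c\<bar>" if "y \<in> {cyl_lo v..?r}" for y
    proof -
      have "y \<in> cyl a f v" using sub that by blast
      then have "coding y (T x) = coding x (T x)" using mem_cyl_iff[OF V[OF v(1)]] x(2) by simp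
      then have "P y (T x)" using P_cong[OF T[OF x(1)]] by simp
      then show ?thesis by (simp add: P_def)
    qed
    moreover have "k \<le> T x" using T[OF x(1)] by (simp add: P_def)
    ultimately show ?thesis using ends lh v(2)
      by (intro exI[of _ "cyl_lo v"] exI[of _ ?r]) auto
  qed
  moreover have "\<epsilon> > 0" "\<eta> > 0" using \<epsilon>1 \<sigma>(1) qc by (auto simp: \<epsilon>_def \<eta>_def)
  ultimately show ?thesis by blast
qed

text \<open>If the full-dimensional frequency vector gives 0 an abnormal frequency, it serves.
  Otherwise condition (ii) for the word 0, with \<delta> = 1 - t, supplies a vector that differs
  there.\<close>

lemma zero_frequency_set_of_large_dim:
  assumes "cond_ii g a f" "t < 1"
  shows "\<exists>G q. G \<subseteq> {0..<1} \<and> (\<forall>y\<in>G. (\<lambda>N. real (zero_count y N) / real N) \<longlonglongrightarrow> q) \<and>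
    q \<noteq> len [0] \<and> t < hausdorff_dim G"
proof -
  have w: "[0] \<in> words g 1" using g_ge_2 by (simp add: words_def)
  obtain p where p: "hausdorff_dim (freq_set g a f 1 p) = 1"
    "\<forall>w\<in>words g 1. \<forall>\<delta>>0. \<exists>q. prob_vector g 1 q \<and> q w \<noteq> p w \<and> hausdorff_dim (freq_set g a f 1 q) > 1 - \<delta>"
    using assms(1) unfolding cond_ii_def by (meson le_refl)
  have "\<exists>q. q [0] \<noteq> len [0] \<and> t < hausdorff_dim (freq_set g a f 1 q)"
  proof (cases "p [0] = len [0]")
    case True
    then show ?thesis using p(2)[rule_format, OF w, of "1 - t"] assms(2) by auto
  next
    case False
    then show ?thesis using p(1) assms(2) by auto
  qed
  then obtain q where q: "q [0] \<noteq> len [0]" "t < hausdorff_dim (freq_set g a f 1 q)" by blast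
  moreover have "freq_set g a f 1 q \<subseteq> {0..<1}" by (auto simp: freq_set_def)
  moreover have "\<forall>y\<in>freq_set g a f 1 q. (\<lambda>N. real (zero_count y N) / real N) \<longlonglongrightarrow> q [0]"
    using zero_frequency_if_freq_set by blast
  ultimately show ?thesis by blast
qed

end

section \<open>Nested sparse intervals for all maps\<close>

text \<open>A cover interval through x meets every nested interval, so its own cost would be at most
  1 / (n + 1) for all n, against \<open>0 < e j\<close>.\<close>

lemma sparse_limit_not_covered:
  assumes "0 < e j" "\<And>n::nat. sparse p e s (1 / (real n + 1)) (l n) (r n)" "\<And>n. x \<in> {l n..r n}"
    "\<And>n. r n - l n \<le> 1" "0 < s"
  shows "x \<notin> {p j..p j + e j}"
proof
  assume x: "x \<in> {p j..p j + e j}"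
  obtain n :: nat where n: "inverse (real (Suc n)) < e j powr s"
    using reals_Archimedean[of "e j powr s"] assms(1) by auto
  have "{p j..p j + e j} \<inter> {l n..r n} \<noteq> {}" using x assms(3)[of n] by blast
  then have "e j powr s \<le> 1 / (real n + 1) * (r n - l n) powr s"
    using assms(2)[of n, unfolded sparse_def, rule_format, of "{j}"] by simp
  also have "\<dots> \<le> 1 / (real n + 1) * 1 powr s"
    using assms(3)[of n] assms(4)[of n] assms(5) by (intro mult_left_mono powr_mono2) auto
  finally show False using n by (simp add: inverse_eq_divide add.commute)
qed

theorem mainTheorem1:
  fixes f :: "nat \<Rightarrow> real \<Rightarrow> real" and g :: "nat \<Rightarrow> nat" and a :: "nat \<Rightarrow> nat \<Rightarrow> real"
  assumes "\<And>i. admissible_map (g i) (a i) (f i)"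
      and "\<And>i. bounded_distortion (g i) (a i) (f i)"
      and "\<And>i. cond_ii (g i) (a i) (f i)"
  shows "hausdorff_dim {x \<in> {0..<1}. \<forall>i. \<forall>m\<ge>1. \<not> m_normal (g i) (a i) (f i) m x} = 1"
proof (rule hausdorff_dim_eq_1)
  let ?X = "{x \<in> {0..<1}. \<forall>i. \<forall>m\<ge>1. \<not> m_normal (g i) (a i) (f i) m x}"
  show "?X \<subseteq> {0..<1}" by auto
  fix s :: real assume s: "0 < s" "s < 1"
  interpret M: expanding_map "g i" "a i" "f i" for i using assms by unfold_locales
  let ?dev = "\<lambda>i x N. \<bar>real (M.zero_count i x N) / real N - M.len i [0]\<bar>"
  define t where "t = (s + 1) / 2"
  have t: "0 < t" "s < t" "t < 1" using s by (auto simp: t_def)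
  \<comment> \<open>Names the refinement property so that the constants of all maps can be chosen
    simultaneously.\<close>
  define Step where "Step i \<epsilon> \<eta> \<longleftrightarrow> (\<forall>\<epsilon>'>0. \<forall>p e l r k. (\<forall>j. 0 < e j) \<longrightarrow> 0 \<le> l \<longrightarrow> l < r \<longrightarrow> r < 1 \<longrightarrow>
      sparse p e s \<epsilon> l r \<longrightarrow> (\<exists>l' r'. l \<le> l' \<and> l' < r' \<and> r' \<le> r \<and> sparse p e s \<epsilon>' l' r' \<and>
        (\<exists>N\<ge>k. \<forall>x\<in>{l'..r'}. \<eta> < ?dev i x N)))" for i \<epsilon> \<eta>
  have "\<exists>\<epsilon>>0. \<exists>\<eta>>0. Step i \<epsilon> \<eta>" for i
  proof -
    obtain G q where G: "G \<subseteq> {0..<1}" "\<forall>y\<in>G. (\<lambda>N. real (M.zero_count i y N) / real N) \<longlonglongrightarrow> q"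
      "q \<noteq> M.len i [0]" "t < hausdorff_dim G"
      using M.zero_frequency_set_of_large_dim[OF assms(3)[of i] t(3)] by blast
    obtain \<kappa> where \<kappa>: "0 < \<kappa>" "content_ge t G \<kappa>" using content_ge_if_less_dim[OF t(1) G(4)] by blast
    show ?thesis unfolding Step_def
      by (rule M.sparse_deviating_subinterval[OF s(1) t(2) less_imp_le[OF t(3)] \<kappa>(2,1) G(1) bspec[OF G(2)] G(3)])
  qed
  then obtain \<epsilon> \<eta> where \<epsilon>: "\<And>i. 0 < \<epsilon> i" and \<eta>: "\<And>i. 0 < \<eta> i" and step: "\<And>i. Step i (\<epsilon> i) (\<eta> i)"
    by metis
  \<comment> \<open>every map is treated at infinitely many steps\<close>
  define idx where "idx n = fst (prod_decode n)" for n
  \<comment> \<open>Sparse enough for the map treated at step n, and tending to 0 so that the limit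
    point escapes the cover.\<close>
  define \<delta> where "\<delta> n = min (\<epsilon> (idx n)) (1 / (real n + 1))" for n
  have \<delta>: "0 < \<delta> n" for n using \<epsilon> by (simp add: \<delta>_def)
  show "hausdorff_measure s ?X \<noteq> 0"
  proof
    assume zero: "hausdorff_measure s ?X = 0"
    \<comment> \<open>With this total cost the starting interval [0,1/2] is sparse at level
      \<open>\<delta> 0\<close>, whichever cover intervals meet it.\<close>
    have "0 < \<delta> 0 * (1 / 2) powr s" using \<delta> by simp
    from small_interval_cover[OF zero s(1) this]
    obtain p e :: "nat \<Rightarrow> real" where pe: "(\<forall>j. 0 < e j) \<and> ?X \<subseteq> (\<Union>j. {p j..p j + e j}) \<and>
        (\<forall>F. finite F \<longrightarrow> (\<Sum>j\<in>F. e j powr s) \<le> \<delta> 0 * (1 / 2) powr s)"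
      by (elim exE) (rule that)
    note e = pe[THEN conjunct1] and cover = pe[THEN conjunct2, THEN conjunct1]
      and sum = pe[THEN conjunct2, THEN conjunct2]
    define Inv where "Inv n I \<longleftrightarrow> 0 \<le> fst I \<and> fst I < snd I \<and> snd I < 1 \<and> sparse p e s (\<delta> n) (fst I) (snd I)"
      for n and I :: "real \<times> real"
    \<comment> \<open>The deviation time is at least n, so each map deviates at arbitrarily late
      times.\<close>
    define Next where "Next n I J \<longleftrightarrow> fst I \<le> fst J \<and> snd J \<le> snd I \<and>
      (\<exists>N\<ge>n. \<forall>x\<in>{fst J..snd J}. \<eta> (idx n) < ?dev (idx n) x N)" for n and I J :: "real \<times> real"
    have base: "\<exists>I. Inv 0 I" 
      by (rule exI[of _ "(0, 1/2)"]) (use sum in \<open>simp add: Inv_def sparse_def\<close>)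
    have next_I: "\<exists>J. Inv (Suc n) J \<and> Next n I J" if I: "Inv n I" for n I
    proof -
      have "sparse p e s (\<delta> n) (fst I) (snd I)" "\<delta> n \<le> \<epsilon> (idx n)" using I by (auto simp: Inv_def \<delta>_def)
      then have "sparse p e s (\<epsilon> (idx n)) (fst I) (snd I)" by (rule sparse_mono)
      moreover have "0 \<le> fst I" "fst I < snd I" "snd I < 1" using I by (auto simp: Inv_def)
      ultimately have "\<exists>l' r'. fst I \<le> l' \<and> l' < r' \<and> r' \<le> snd I \<and> sparse p e s (\<delta> (Suc n)) l' r' \<and>
        (\<exists>N\<ge>n. \<forall>x\<in>{l'..r'}. \<eta> (idx n) < ?dev (idx n) x N)"
        using e by (intro step[of "idx n", unfolded Step_def, rule_format] \<delta>) simp_all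
      then obtain l' r' where "fst I \<le> l'" "l' < r'" "r' \<le> snd I" "sparse p e s (\<delta> (Suc n)) l' r'"
        "\<exists>N\<ge>n. \<forall>x\<in>{l'..r'}. \<eta> (idx n) < ?dev (idx n) x N"
        by blast
      then show ?thesis using I by (intro exI[of _ "(l', r')"]) (auto simp: Inv_def Next_def)
    qed
    obtain I where I: "\<And>n. Inv n (I n)" "\<And>n. Next n (I n) (I (Suc n))"
      using dependent_nat_choice[where P = Inv and Q = Next, OF base next_I] by blast
    define l where "l n = fst (I n)" for n
    define r where "r n = snd (I n)" for n
    have inc: "incseq l" and dec: "decseq r"
      using I(2) by (auto simp: Next_def l_def r_def intro!: incseq_SucI decseq_SucI)
    have "l m \<le> r n" for m n
    proof -
      have "l m \<le> l (max m n)" using inc by (simp add: incseqD)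
      also have "\<dots> < r (max m n)" using I(1) by (simp add: Inv_def l_def r_def)
      also have "\<dots> \<le> r n" using dec by (simp add: decseqD)
      finally show ?thesis by simp
    qed
    note l_le_r = this
    \<comment> \<open>The supremum of the left ends lies in all the nested closed intervals.\<close>
    define x where "x = (SUP n. l n)"
    have x: "x \<in> {l n..r n}" for n
      using l_le_r by (auto simp: x_def intro!: cSUP_upper cSUP_least bdd_aboveI[of _ "r 0"])
    have x01: "x \<in> {0..<1}" using x[of 0] I(1)[of 0] by (auto simp: Inv_def l_def r_def)
    have "\<not> m_normal (g i) (a i) (f i) m x" if "1 \<le> m" for i m
    proof
      assume "m_normal (g i) (a i) (f i) m x"
      then have "(\<lambda>N. real (M.zero_count i x N) / real N) \<longlonglongrightarrow> M.len i [0]"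
        by (rule M.zero_frequency_if_m_normal[OF x01 that])
      then have "eventually (\<lambda>N. dist (real (M.zero_count i x N) / real N) (M.len i [0]) < \<eta> i) sequentially"
        using \<eta> by (rule tendstoD)
      then obtain N0 where N0: "\<And>N. N \<ge> N0 \<Longrightarrow> ?dev i x N < \<eta> i"
        by (auto simp: eventually_sequentially dist_real_def)
      \<comment> \<open>A step that treats map i and is no earlier than N0, since a code of a pair
        is at least its second component.\<close>
      define n where "n = prod_encode (i, N0)"
      have n: "idx n = i" "N0 \<le> n" by (simp_all add: n_def idx_def le_prod_encode_2)
      obtain N where "N \<ge> n" "\<eta> (idx n) < ?dev (idx n) x N"
        using I(2)[of n] x[of "Suc n"] unfolding Next_def l_def r_def by blast
      then show False using N0[of N] n by simp
    qed
    then have "x \<in> ?X" using x01 by blast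
    then obtain j where "x \<in> {p j..p j + e j}" using cover by blast
    moreover have "x \<notin> {p j..p j + e j}"
    proof (rule sparse_limit_not_covered[OF spec[OF e] _ x _ s(1)])
      show "sparse p e s (1 / (real n + 1)) (l n) (r n)" for n
        using I(1)[of n] sparse_mono[of p e s "\<delta> n"] by (auto simp: Inv_def l_def r_def \<delta>_def)
      show "r n - l n \<le> 1" for n using I(1)[of n] by (simp add: Inv_def l_def r_def)
    qed
    ultimately show False by blast
  qed
qed

end
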